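(* Let $L=2$ and suppose that, as $\gamma\to\infty$, the transient duration $d_1=d_1(\gamma)\to\infty$ with $d_1\sim c_1\frac{\log\gamma}{I_1}$ for some constant $c_1\in[0,\infty]$. (i) If $c_1\ge 1$, then as $\gamma\to\infty$, $$\inf_{\tau\in\mathcal C_\gamma}J^{d_1}_{\mathrm L}(\tau)\ \ge\ \inf_{\tau\in\mathcal C_\gamma}J^{d_1}_{\mathrm P}(\tau)\ \ge\ \frac{\log\gamma}{I_1}(1-o(1)).$$ (ii) If $c_1<1$, then as $\gamma\to\infty$, $$\inf_{\tau\in\mathcal C_\gamma}J^{d_1}_{\mathrm L}(\tau)\ \ge\ \inf_{\tau\in\mathcal C_\gamma}J^{d_1}_{\mathrm P}(\tau)\ \ge\ \log\gamma\left(\frac{1-c_1}{I_2}+\frac{c_1}{I_1}\right)(1-o(1)).$$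
   Context: Model ($L=2$). $f_0,f_1,f_2$ are known probability densities with respect to a common measure, and $I_i=\int f_i\log\frac{f_i}{f_0}$, $i=1,2$, are assumed positive and finite. Independent random variables $X_1,X_2,\dots$ are observed sequentially, $\mathcal F_k=\sigma(X_1,\dots,X_k)$. For a change-point $v_1\ge1$ and transient duration $d_1$ (a nonnegative integer), under $\mathbb{P}^{d_1}_{v_1}$ (expectation $\mathbb{E}^{d_1}_{v_1}$) the $X_k$ are independent with $X_k\sim f_0$ for $k<v_1$, $X_k\sim f_1$ for $v_1\le k<v_1+d_1$, and $X_k\sim f_2$ for $k\ge v_1+d_1$. Under $\mathbb{P}_\infty$ (expectation $\mathbb{E}_\infty$) all $X_k$ are i.i.d. with density $f_0$. For $\gamma>1$, $\mathcal C_\gamma$ is the set of $\{\mathcal F_k\}$-stopping times $\tau$ with $\mathbb{E}_\infty[\tau]\ge\gamma$. The worst-case average detection delays are $J^{d_1}_{\mathrm P}(\tau)=\sup_{v_1\ge1}\mathbb{E}^{d_1}_{v_1}[\tau-v_1\mid\tau\ge v_1]$ (Pollak) and $J^{d_1}_{\mathrm L}(\tau)=\sup_{v_1\ge1}\operatorname{ess\,sup}\mathbb{E}^{d_1}_{v_1}[(\tau-v_1)^+\mid X_1,\dots,X_{v_1-1}]$ (Lorden). Convention: $d_1\sim c_1\log\gamma/I_1$ means that the ratio $d_1 I_1/\log\gamma\to c_1$; in particular $c_1=0$ means $d_1=o(\log\gamma)$ and $c_1=\infty$ means $\log\gamma=o(d_1)$. *)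

theory Defs
  imports "HOL-Probability.Probability"
begin

definition prob_dens :: "'a measure \<Rightarrow> ('a \<Rightarrow> real) \<Rightarrow> bool" where
  "prob_dens \<mu> f \<longleftrightarrow>
     f \<in> borel_measurable \<mu> \<and> (\<forall>x\<in>space \<mu>. 0 \<le> f x) \<and> (\<integral>\<^sup>+x. ennreal (f x) \<partial>\<mu>) = 1"

text \<open>
  The number \<open>\<integral> f log (f / g)\<close>, in nats. As a Bochner integral it is a meaningful value only
  under \<open>KL_finite\<close>: Isabelle sets \<open>x / 0 = 0\<close> and \<open>ln 0 = 0\<close>, so the convention
  \<open>f log (f / 0) = \<infinity>\<close> for \<open>f > 0\<close> has to be imposed separately. The negative part of
  the integrand is always integrable, so for probability densities \<open>KL_finite\<close> says exactly
  that the information number is not \<open>\<infinity>\<close>.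
\<close>

definition KL_info :: "'a measure \<Rightarrow> ('a \<Rightarrow> real) \<Rightarrow> ('a \<Rightarrow> real) \<Rightarrow> real" where
  "KL_info \<mu> f g = (LINT x|\<mu>. f x * ln (f x / g x))"

definition KL_finite :: "'a measure \<Rightarrow> ('a \<Rightarrow> real) \<Rightarrow> ('a \<Rightarrow> real) \<Rightarrow> bool" where
  "KL_finite \<mu> f g \<longleftrightarrow>
     (AE x in \<mu>. g x = 0 \<longrightarrow> f x = 0) \<and> integrable \<mu> (\<lambda>x. f x * ln (f x / g x))"

definition regime :: "'b \<Rightarrow> 'b \<Rightarrow> 'b \<Rightarrow> nat \<Rightarrow> nat \<Rightarrow> nat \<Rightarrow> 'b" where
  "regime f0 f1 f2 d v k = (if k < v then f0 else if k < v + d then f1 else f2)"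

text \<open>
  Observations are \<open>X 1, X 2, \<dots>\<close>; \<open>X 0\<close> plays no role. The measures \<open>Pinf\<close> and \<open>P d v\<close>
  (transient duration \<open>d\<close>, change-point \<open>v \<ge> 1\<close>) live on the same measurable space, and \<open>P d 0\<close>
  is unconstrained.
\<close>

locale transient_change_model =
  fixes \<mu> :: "'a measure"
    and f0 f1 f2 :: "'a \<Rightarrow> real"
    and Pinf :: "'w measure"
    and P :: "nat \<Rightarrow> nat \<Rightarrow> 'w measure"
    and X :: "nat \<Rightarrow> 'w \<Rightarrow> 'a"
  assumes dens: "prob_dens \<mu> f0" "prob_dens \<mu> f1" "prob_dens \<mu> f2"
    and info_finite: "KL_finite \<mu> f1 f0" "KL_finite \<mu> f2 f0"
    and info_pos: "0 < KL_info \<mu> f1 f0" "0 < KL_info \<mu> f2 f0"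
    and prob_inf: "prob_space Pinf"
    and indep_inf: "prob_space.indep_vars Pinf (\<lambda>_. \<mu>) X {1..}"
    and distr_inf: "\<And>k. 1 \<le> k \<Longrightarrow> distributed Pinf \<mu> (X k) (\<lambda>x. ennreal (f0 x))"
    and prob_P: "\<And>d v. 1 \<le> v \<Longrightarrow> prob_space (P d v)"
    and sets_P: "\<And>d v. 1 \<le> v \<Longrightarrow> sets (P d v) = sets Pinf"
    and indep_P: "\<And>d v. 1 \<le> v \<Longrightarrow> prob_space.indep_vars (P d v) (\<lambda>_. \<mu>) X {1..}"
    and distr_P: "\<And>d v k. 1 \<le> v \<Longrightarrow> 1 \<le> k \<Longrightarrow>
      distributed (P d v) \<mu> (X k) (\<lambda>x. ennreal (regime f0 f1 f2 d v k x))"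

text \<open>
  The filtration \<open>\<F>\<^sub>k = \<sigma>(X\<^sub>1, \<dots>, X\<^sub>k)\<close> on a sample space \<open>\<Omega>\<close>, with \<open>\<F>\<^sub>0\<close> trivial. It is
  indexed by \<^typ>\<open>enat\<close>, with \<open>\<F>\<^sub>\<infinity>\<close> generated by all observations, since stopping times
  are allowed to take the value \<open>\<infinity>\<close> (never stopping).
\<close>

definition obs_filtration :: "'w set \<Rightarrow> 'a measure \<Rightarrow> (nat \<Rightarrow> 'w \<Rightarrow> 'a) \<Rightarrow> enat \<Rightarrow> 'w measure" where
  "obs_filtration \<Omega> \<mu> X t =
     sigma \<Omega> {X k -` A \<inter> \<Omega> | k A. 1 \<le> k \<and> enat k \<le> t \<and> A \<in> sets \<mu>}"

definition arl_class :: "'w measure \<Rightarrow> (enat \<Rightarrow> 'w measure) \<Rightarrow> real \<Rightarrow> ('w \<Rightarrow> enat) set" where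
  "arl_class Pinf F \<gamma> =
     {\<tau>. stopping_time F \<tau> \<and> ennreal \<gamma> \<le> (\<integral>\<^sup>+\<omega>. ennreal_of_enat (\<tau> \<omega>) \<partial>Pinf)}"

text \<open>
  In the two delay functionals \<open>Q v\<close> is the law with change-point \<open>v\<close>. Subtraction on
  \<^typ>\<open>enat\<close> is truncated and satisfies \<open>\<infinity> - enat v = \<infinity>\<close>, so \<open>\<tau> \<omega> - enat v\<close> is the
  positive part. If the event \<open>\<tau> \<ge> v\<close> is null then the conditional measure is the null measure
  and \<open>v\<close> does not contribute to the supremum.
\<close>

definition pollak_delay :: "(nat \<Rightarrow> 'w measure) \<Rightarrow> ('w \<Rightarrow> enat) \<Rightarrow> ennreal" where
  "pollak_delay Q \<tau> =
     (SUP v\<in>{1..}. \<integral>\<^sup>+\<omega>. ennreal_of_enat (\<tau> \<omega> - enat v)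
        \<partial>uniform_measure (Q v) {\<omega> \<in> space (Q v). enat v \<le> \<tau> \<omega>})"

definition lorden_delay ::
  "(nat \<Rightarrow> 'w measure) \<Rightarrow> (enat \<Rightarrow> 'w measure) \<Rightarrow> ('w \<Rightarrow> enat) \<Rightarrow> ennreal" where
  "lorden_delay Q F \<tau> =
     (SUP v\<in>{1..}. esssup (Q v)
        (nn_cond_exp (Q v) (F (enat (v - 1))) (\<lambda>\<omega>. ennreal_of_enat (\<tau> \<omega> - enat v))))"

end

theory Submission
  imports Defs "HOL-Real_Asymp.Real_Asymp"
begin

text \<open>
  Summing over \<open>v\<close> and using that \<open>\<Sum>\<^sub>v P\<^sub>\<infinity>(\<tau> \<ge> v)\<close> is the average run length, some window
  \<open>[v, v + m)\<close> satisfies \<open>P\<^sub>\<infinity>(v \<le> \<tau> < v + m) < (2 m / \<gamma>) P\<^sub>\<infinity>(\<tau> \<ge> v)\<close>. Stopping in the window is an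
  event of \<open>\<F>\<close> at time \<open>v + m - 1\<close>, so a change of measure costs at most a factor \<open>e\<^sup>a\<close> off the event
  that the log-likelihood ratio of \<open>X\<^sub>v, \<dots>, X\<close> up to that time exceeds \<open>a\<close>. With \<open>a = \<alpha> log \<gamma>\<close>, \<open>\<alpha> < 1\<close>,
  and \<open>m\<close> a multiple of \<open>log \<gamma>\<close> for which the mean log-likelihood ratio
  \<open>min(m, d) I\<^sub>1 + (m - d)\<^sup>+ I\<^sub>2\<close> stays below \<open>a\<close>, the weak law of large numbers makes the exceptional
  event negligible uniformly in \<open>v\<close>. No maximal inequality is needed, and the weak law for merely
  integrable summands follows by truncation. The largest admissible \<open>m\<close> gives the two rates.
\<close>

subsection \<open>An \<open>L\<^sup>1\<close> weak law of large numbers\<close>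

text \<open>Independence and centring kill the cross terms, so each new summand adds at most
  \<open>c\<^sup>2\<close> and the bound is linear in the number of summands, not quadratic.\<close>

lemma (in prob_space) second_moment_indep_sum_le:
  fixes Y :: "'i \<Rightarrow> 'a \<Rightarrow> real"
  assumes "finite J" "indep_vars (\<lambda>_. borel) Y J"
    and "\<And>k. k \<in> J \<Longrightarrow> expectation (Y k) = 0"
    and "\<And>k \<omega>. k \<in> J \<Longrightarrow> \<bar>Y k \<omega>\<bar> \<le> c"
  shows "expectation (\<lambda>\<omega>. (\<Sum>k\<in>J. Y k \<omega>)\<^sup>2) \<le> real (card J) * c\<^sup>2"
  using assms
proof (induction J rule: finite_induct)
  case empty
  then show ?case by simp
next
  case (insert i J)
  define S where "S = (\<lambda>\<omega>. \<Sum>k\<in>J. Y k \<omega>)"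
  have ind: "indep_vars (\<lambda>_. borel) Y J"
    using insert.prems(1) by (rule indep_vars_subset) auto
  have meas: "Y k \<in> borel_measurable M" if "k \<in> insert i J" for k
    using insert.prems(1) that by (auto simp: indep_vars_def)
  have [measurable]: "S \<in> borel_measurable M" "Y i \<in> borel_measurable M"
    unfolding S_def by (intro borel_measurable_sum meas, auto intro: meas)
  have bS: "\<bar>S \<omega>\<bar> \<le> real (card J) * c" for \<omega>
  proof -
    have "\<bar>S \<omega>\<bar> \<le> (\<Sum>k\<in>J. \<bar>Y k \<omega>\<bar>)" unfolding S_def by (rule sum_abs)
    also have "\<dots> \<le> real (card J) * c"
      using insert.prems(3) by (intro sum_bounded_above) auto
    finally show ?thesis .
  qed
  \<comment> \<open>The bound is assumed at every point of the type, so an arbitrary point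
    serves.\<close>
  have c0: "0 \<le> c" using insert.prems(3)[of i undefined] abs_ge_zero[of "Y i undefined"] by simp
  have bY: "\<bar>Y i \<omega>\<bar> \<le> c" for \<omega> using insert.prems(3) by auto
  have int: "integrable M S" "integrable M (Y i)"
    using bS by (intro integrable_const_bound[where B = "real (card J) * c"]; simp)
      (use bY in \<open>intro integrable_const_bound[where B = c]; simp\<close>)
  have intY: "integrable M (Y k)" if "k \<in> J" for k
    using insert.prems(3) that meas by (auto intro!: integrable_const_bound[where B = c])
  have "expectation S = 0"
    unfolding S_def using insert.prems(2) intY by (subst Bochner_Integration.integral_sum) auto
  have iv: "indep_var borel (Y i) borel S"
    unfolding S_def using insert by (intro indep_vars_sum) auto
  have prod: "expectation (\<lambda>\<omega>. Y i \<omega> * S \<omega>) = 0"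
    using indep_var_lebesgue_integral[OF iv int(2) int(1)] \<open>expectation S = 0\<close> by simp
  have iprod: "integrable M (\<lambda>\<omega>. Y i \<omega> * S \<omega>)"
    using indep_var_integrable[OF iv int(2) int(1)] .
  have sq: "(Y i \<omega>)\<^sup>2 \<le> c\<^sup>2" for \<omega>
    using bY[of \<omega>] c0 by (metis abs_ge_zero power2_abs power_mono)
  have isq: "integrable M (\<lambda>\<omega>. (Y i \<omega>)\<^sup>2)"
    using sq by (auto intro!: integrable_const_bound[where B = "c\<^sup>2"])
  have isqS: "integrable M (\<lambda>\<omega>. (S \<omega>)\<^sup>2)"
    using bS by (auto intro!: integrable_const_bound[where B = "(real (card J) * c)\<^sup>2"] AE_I2
        simp: abs_le_square_iff[symmetric]) (smt (verit))
  have "expectation (\<lambda>\<omega>. (\<Sum>k\<in>insert i J. Y k \<omega>)\<^sup>2)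
      = expectation (\<lambda>\<omega>. (Y i \<omega>)\<^sup>2 + (S \<omega>)\<^sup>2 + 2 * (Y i \<omega> * S \<omega>))"
    using insert.hyps by (simp add: S_def power2_sum mult.assoc)
  also have "\<dots> = expectation (\<lambda>\<omega>. (Y i \<omega>)\<^sup>2) + expectation (\<lambda>\<omega>. (S \<omega>)\<^sup>2)"
    using prod iprod isq isqS by simp
  also have "\<dots> \<le> c\<^sup>2 + real (card J) * c\<^sup>2"
  proof (intro add_mono)
    show "expectation (\<lambda>\<omega>. (Y i \<omega>)\<^sup>2) \<le> c\<^sup>2"
      using isq sq by (intro integral_le_const) auto
    show "expectation (\<lambda>\<omega>. (S \<omega>)\<^sup>2) \<le> real (card J) * c\<^sup>2"
      unfolding S_def using insert.prems ind by (intro insert.IH) auto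
  qed
  finally show ?case using insert.hyps by (simp add: algebra_simps)
qed

text \<open>The variance of |Y| is nonnegative.\<close>

lemma (in prob_space) expectation_abs_le_sqrt:
  fixes Y :: "'a \<Rightarrow> real"
  assumes "integrable M Y" "integrable M (\<lambda>\<omega>. (Y \<omega>)\<^sup>2)"
  shows "expectation (\<lambda>\<omega>. \<bar>Y \<omega>\<bar>) \<le> sqrt (expectation (\<lambda>\<omega>. (Y \<omega>)\<^sup>2))"
proof -
  have "0 \<le> variance (\<lambda>\<omega>. \<bar>Y \<omega>\<bar>)" by (rule variance_positive)
  also have "\<dots> = expectation (\<lambda>\<omega>. (Y \<omega>)\<^sup>2) - (expectation (\<lambda>\<omega>. \<bar>Y \<omega>\<bar>))\<^sup>2"
    using assms by (subst variance_eq) auto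
  finally show ?thesis by (intro real_le_rsqrt) simp
qed

text \<open>Each summand is a bounded part \<open>B\<close> plus a tail \<open>T\<close> that is
  small in mean. Centred, the bounded parts are controlled in second moment through independence,
  which gives the square root; the tails go through the triangle inequality, which gives the linear
  term with the small factor \<eta>. The bound involves nothing of the laws beyond \<open>K\<close>
  and \<eta>, which is what makes it uniform later.\<close>

lemma (in prob_space) expectation_abs_centered_sum_le:
  fixes B T :: "'i \<Rightarrow> 'a \<Rightarrow> real"
  assumes J: "finite J" and ind: "indep_vars (\<lambda>_. borel) B J"
    and B: "\<And>k \<omega>. k \<in> J \<Longrightarrow> \<bar>B k \<omega>\<bar> \<le> K"
    and T: "\<And>k. k \<in> J \<Longrightarrow> integrable M (T k)"
      "\<And>k. k \<in> J \<Longrightarrow> expectation (\<lambda>\<omega>. \<bar>T k \<omega>\<bar>) \<le> \<eta>"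
    and mean: "(\<Sum>k\<in>J. expectation (\<lambda>\<omega>. B k \<omega> + T k \<omega>)) = s"
  shows "expectation (\<lambda>\<omega>. \<bar>(\<Sum>k\<in>J. B k \<omega> + T k \<omega>) - s\<bar>)
    \<le> 2 * \<eta> * real (card J) + 2 * K * sqrt (real (card J))"
proof (cases "J = {}")
  case True
  then show ?thesis using mean by simp
next
  case False
  then have K0: "0 \<le> K" using B by fastforce
  have Bm: "B k \<in> borel_measurable M" if "k \<in> J" for k
    using ind that by (auto simp: indep_vars_def)
  have Bi: "integrable M (B k)" if "k \<in> J" for k
    using B Bm that by (auto intro!: integrable_const_bound[where B = K])
  define Y where "Y = (\<lambda>k \<omega>. B k \<omega> - expectation (B k))"
  define U where "U = (\<lambda>k \<omega>. T k \<omega> - expectation (T k))"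
  define SY where "SY = (\<lambda>\<omega>. \<Sum>k\<in>J. Y k \<omega>)"
  have Yi: "integrable M (Y k)" if "k \<in> J" for k
    unfolding Y_def using Bi that by auto
  have Yb: "\<bar>Y k \<omega>\<bar> \<le> 2 * K" if "k \<in> J" for k \<omega>
  proof -
    have "\<bar>expectation (B k)\<bar> \<le> expectation (\<lambda>\<omega>. \<bar>B k \<omega>\<bar>)"
      using integral_abs_bound by blast
    also have "\<dots> \<le> K" using Bi B that by (intro integral_le_const) auto
    finally show ?thesis using B[OF that, of \<omega>] unfolding Y_def by linarith
  qed
  have Yind: "indep_vars (\<lambda>_. borel) Y J"
    unfolding Y_def using ind by (rule indep_vars_compose2) auto
  have SYm [measurable]: "SY \<in> borel_measurable M"
    unfolding SY_def using Yi by (intro borel_measurable_sum) auto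
  have SYb: "\<bar>SY \<omega>\<bar> \<le> real (card J) * (2 * K)" for \<omega>
    unfolding SY_def using Yb by (intro order_trans[OF sum_abs] sum_bounded_above) auto
  have SYi: "integrable M SY"
    unfolding SY_def using Yi by auto
  have SYi2: "integrable M (\<lambda>\<omega>. (SY \<omega>)\<^sup>2)"
    using SYb K0 by (auto intro!: integrable_const_bound[where B = "(real (card J) * (2 * K))\<^sup>2"] AE_I2
        simp: abs_le_square_iff[symmetric] abs_mult)
  have "expectation (\<lambda>\<omega>. (SY \<omega>)\<^sup>2) \<le> real (card J) * (2 * K)\<^sup>2"
    unfolding SY_def
  proof (rule second_moment_indep_sum_le[OF J Yind])
    show "expectation (Y k) = 0" if "k \<in> J" for k
      unfolding Y_def using Bi that by (simp add: prob_space)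
  qed (rule Yb)
  then have "sqrt (expectation (\<lambda>\<omega>. (SY \<omega>)\<^sup>2)) \<le> 2 * K * sqrt (real (card J))"
    using K0 by (intro real_le_lsqrt) (auto simp: power_mult_distrib mult.commute)
  with expectation_abs_le_sqrt[OF SYi SYi2]
  have SY1: "expectation (\<lambda>\<omega>. \<bar>SY \<omega>\<bar>) \<le> 2 * K * sqrt (real (card J))" by linarith
  have Ui: "integrable M (U k)" if "k \<in> J" for k
    unfolding U_def using T that by auto
  have U1: "expectation (\<lambda>\<omega>. \<bar>U k \<omega>\<bar>) \<le> 2 * \<eta>" if "k \<in> J" for k
  proof -
    have "expectation (\<lambda>\<omega>. \<bar>U k \<omega>\<bar>) \<le> expectation (\<lambda>\<omega>. \<bar>T k \<omega>\<bar> + \<bar>expectation (T k)\<bar>)"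
      unfolding U_def using T that by (intro integral_mono) auto
    also have "\<dots> = expectation (\<lambda>\<omega>. \<bar>T k \<omega>\<bar>) + \<bar>expectation (T k)\<bar>"
      using T that by (simp add: prob_space)
    also have "\<bar>expectation (T k)\<bar> \<le> expectation (\<lambda>\<omega>. \<bar>T k \<omega>\<bar>)"
      using integral_abs_bound by blast
    finally show ?thesis using T(2)[OF that] by linarith
  qed
  have split: "(\<Sum>k\<in>J. B k \<omega> + T k \<omega>) - s = SY \<omega> + (\<Sum>k\<in>J. U k \<omega>)" for \<omega>
    unfolding mean[symmetric] SY_def Y_def U_def using Bi T
    by (simp add: sum.distrib sum_subtractf)
  have "expectation (\<lambda>\<omega>. \<bar>(\<Sum>k\<in>J. B k \<omega> + T k \<omega>) - s\<bar>)
      \<le> expectation (\<lambda>\<omega>. \<bar>SY \<omega>\<bar> + (\<Sum>k\<in>J. \<bar>U k \<omega>\<bar>))"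
  proof (rule integral_mono)
    show "integrable M (\<lambda>\<omega>. \<bar>(\<Sum>k\<in>J. B k \<omega> + T k \<omega>) - s\<bar>)"
      unfolding split using SYi Ui by auto
    show "integrable M (\<lambda>\<omega>. \<bar>SY \<omega>\<bar> + (\<Sum>k\<in>J. \<bar>U k \<omega>\<bar>))"
      using SYi Ui by auto
    show "\<bar>(\<Sum>k\<in>J. B k \<omega> + T k \<omega>) - s\<bar> \<le> \<bar>SY \<omega>\<bar> + (\<Sum>k\<in>J. \<bar>U k \<omega>\<bar>)" for \<omega>
      unfolding split using sum_abs[of "\<lambda>k. U k \<omega>" J] by linarith
  qed
  also have "\<dots> = expectation (\<lambda>\<omega>. \<bar>SY \<omega>\<bar>) + (\<Sum>k\<in>J. expectation (\<lambda>\<omega>. \<bar>U k \<omega>\<bar>))"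
    using SYi Ui by simp
  also have "(\<Sum>k\<in>J. expectation (\<lambda>\<omega>. \<bar>U k \<omega>\<bar>)) \<le> real (card J) * (2 * \<eta>)"
    using U1 by (intro sum_bounded_above) auto
  finally show ?thesis using SY1 by (simp add: algebra_simps)
qed

text \<open>Dominated convergence with dominating function |w h|: at a fixed point the integrand
  vanishes once \<open>k\<close> exceeds |h x|. In the application \<open>w\<close> is a post-change
  density and \<open>h\<close> a log-likelihood ratio.\<close>

lemma truncation_tail_small:
  fixes w h :: "'b \<Rightarrow> real"
  assumes int: "integrable N (\<lambda>x. w x * h x)"
    and [measurable]: "w \<in> borel_measurable N" "h \<in> borel_measurable N" and \<eta>: "0 < \<eta>"
  shows "\<exists>k0. \<forall>k\<ge>k0. (LINT x|N. w x * \<bar>if \<bar>h x\<bar> \<le> real k then 0 else h x\<bar>) \<le> \<eta>"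
proof -
  have "(\<lambda>k. LINT x|N. w x * \<bar>if \<bar>h x\<bar> \<le> real k then 0 else h x\<bar>) \<longlonglongrightarrow> (LINT x|N. 0)"
  proof (rule integral_dominated_convergence[where w = "\<lambda>x. \<bar>w x * h x\<bar>"])
    show "AE x in N. (\<lambda>k. w x * \<bar>if \<bar>h x\<bar> \<le> real k then 0 else h x\<bar>) \<longlonglongrightarrow> 0"
    proof (rule AE_I2)
      fix x
      have "\<forall>\<^sub>F k in sequentially. \<bar>h x\<bar> \<le> real k"
        by (metis eventually_sequentiallyI nat_ceiling_le_eq)
      then show "(\<lambda>k. w x * \<bar>if \<bar>h x\<bar> \<le> real k then 0 else h x\<bar>) \<longlonglongrightarrow> 0"
        by (intro tendsto_eventually) (rule eventually_mono, assumption, simp)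
    qed
  qed (use integrable_abs[OF int] in \<open>auto simp: abs_mult\<close>)
  then have "\<forall>\<^sub>F k in sequentially. (LINT x|N. w x * \<bar>if \<bar>h x\<bar> \<le> real k then 0 else h x\<bar>) < \<eta>"
    using \<eta> by (simp add: order_tendsto_iff)
  then show ?thesis by (auto simp: eventually_sequentially intro: less_imp_le)
qed

subsection \<open>Rarely visited windows\<close>

text \<open>If every window were hit too often, summing over all starting points would bound 2m by
  the expected number of windows containing the value of \<tau>, and no value lies in more than m
  windows of length m.\<close>

lemma (in prob_space) exists_rare_window:
  fixes \<tau> :: "'a \<Rightarrow> enat"
  assumes [measurable]: "\<tau> \<in> measurable M (count_space UNIV)"
    and m: "1 \<le> m" and \<gamma>: "0 < \<gamma>" "ennreal \<gamma> \<le> (\<integral>\<^sup>+\<omega>. ennreal_of_enat (\<tau> \<omega>) \<partial>M)"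
  shows "\<exists>v\<ge>1. prob {\<omega> \<in> space M. enat v \<le> \<tau> \<omega> \<and> \<tau> \<omega> < enat (v + m)}
    < 2 * real m / \<gamma> * prob {\<omega> \<in> space M. enat v \<le> \<tau> \<omega>}"
proof (rule ccontr)
  \<comment> \<open>\<open>W t\<close> is the window that starts at \<open>Suc t\<close>; the shift
    matches the tail-sum formula, whose t-th term is the probability of
    \<open>t < \<tau>\<close>.\<close>
  define W where "W = (\<lambda>t. {\<omega> \<in> space M. enat (Suc t) \<le> \<tau> \<omega> \<and> \<tau> \<omega> < enat (Suc t + m)})"
  assume "\<not> ?thesis"
  then have le: "2 * real m / \<gamma> * prob {\<omega> \<in> space M. enat (Suc t) \<le> \<tau> \<omega>} \<le> prob (W t)" for t
    unfolding W_def by (auto simp: not_less)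
  have [measurable]: "W t \<in> sets M" for t unfolding W_def by measurable
  have "ennreal (2 * real m / \<gamma>) * ennreal \<gamma>
      \<le> ennreal (2 * real m / \<gamma>) * (\<Sum>t. emeasure M {\<omega> \<in> space M. enat t < \<tau> \<omega>})"
    using \<gamma>(2) by (subst (asm) nn_integral_enat_function) (auto intro!: mult_left_mono)
  also have "\<dots> = (\<Sum>t. ennreal (2 * real m / \<gamma>) * emeasure M {\<omega> \<in> space M. enat t < \<tau> \<omega>})"
    by simp
  also have "\<dots> \<le> (\<Sum>t. emeasure M (W t))"
  proof (intro suminf_le summableI)
    fix t
    have "ennreal (2 * real m / \<gamma>) * ennreal (prob {\<omega> \<in> space M. enat t < \<tau> \<omega>}) \<le> ennreal (prob (W t))"
      using le[of t] \<gamma>(1) by (subst ennreal_mult[symmetric]) (auto simp: Suc_ile_eq intro!: ennreal_leI)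
    then show "ennreal (2 * real m / \<gamma>) * emeasure M {\<omega> \<in> space M. enat t < \<tau> \<omega>} \<le> emeasure M (W t)"
      by (simp add: emeasure_eq_measure)
  qed
  also have "\<dots> = (\<integral>\<^sup>+\<omega>. (\<Sum>t. indicator (W t) \<omega>) \<partial>M)"
    by (subst nn_integral_suminf) auto
  also have "\<dots> \<le> (\<integral>\<^sup>+\<omega>. ennreal (real m) \<partial>M)"
  proof (rule nn_integral_mono)
    fix \<omega> assume "\<omega> \<in> space M"
    show "(\<Sum>t. indicator (W t) \<omega>) \<le> ennreal (real m)"
    proof (cases "\<tau> \<omega>")
      case infinity
      then show ?thesis by (simp add: W_def)
    next
      case (enat n)
      \<comment> \<open>A finite value n lies in \<open>W t\<close> only for n - m \<le> t < n,
        while an infinite value lies in no window.\<close>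
      have "(\<Sum>t. indicator (W t) \<omega> :: ennreal) = (\<Sum>t\<in>{n - m..<n}. indicator (W t) \<omega>)"
        by (rule suminf_finite) (auto simp: W_def enat indicator_def)
      also have "\<dots> \<le> (\<Sum>t\<in>{n - m..<n}. 1)"
        by (intro sum_mono) (auto simp: indicator_def)
      also have "\<dots> = of_nat (n - (n - m))" by simp
      also have "\<dots> \<le> of_nat m" by (intro of_nat_mono) auto
      finally show ?thesis by (simp add: ennreal_of_nat_eq_real_of_nat)
    qed
  qed
  also have "\<dots> = ennreal (real m)" by (simp add: emeasure_space_1)
  finally have "ennreal (2 * real m / \<gamma> * \<gamma>) \<le> ennreal (real m)"
    using \<gamma> by (subst ennreal_mult) auto
  then have "2 * real m / \<gamma> * \<gamma> \<le> real m" by (subst (asm) ennreal_le_iff) auto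
  then show False using m \<gamma> by simp
qed

subsection \<open>Product measures\<close>

text \<open>A product measure is determined by its values on measurable boxes, and on a box both the
  density and the indicator factor over the coordinates.\<close>

lemma density_PiM:
  assumes I: "finite I" and M: "\<And>i. sigma_finite_measure (M i)"
    and g [measurable]: "\<And>i. g i \<in> borel_measurable (M i)"
    and Mg: "\<And>i. sigma_finite_measure (density (M i) (g i))"
  shows "PiM I (\<lambda>i. density (M i) (g i)) = density (PiM I M) (\<lambda>x. \<Prod>i\<in>I. g i (x i))"
proof -
  interpret D: product_sigma_finite "\<lambda>i. density (M i) (g i)" unfolding product_sigma_finite_def by (intro allI Mg)
  interpret M: product_sigma_finite M unfolding product_sigma_finite_def by (intro allI M)
  show ?thesis
  proof (rule D.PiM_eqI[symmetric, OF I])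
    show "sets (density (PiM I M) (\<lambda>x. \<Prod>i\<in>I. g i (x i))) = sets (PiM I (\<lambda>i. density (M i) (g i)))"
      by (simp cong: sets_PiM_cong)
    fix A assume "\<And>i. i \<in> I \<Longrightarrow> A i \<in> sets (density (M i) (g i))"
    then have A [measurable]: "\<And>i. i \<in> I \<Longrightarrow> A i \<in> sets (M i)" by simp
    have [measurable]: "Pi\<^sub>E I A \<in> sets (PiM I M)" using I A by (intro sets_PiM_I_finite) auto
    have "emeasure (density (PiM I M) (\<lambda>x. \<Prod>i\<in>I. g i (x i))) (Pi\<^sub>E I A)
        = (\<integral>\<^sup>+x. (\<Prod>i\<in>I. g i (x i)) * indicator (Pi\<^sub>E I A) x \<partial>PiM I M)"
      by (subst emeasure_density) auto
    also have "\<dots> = (\<integral>\<^sup>+x. (\<Prod>i\<in>I. g i (x i) * indicator (A i) (x i)) \<partial>PiM I M)"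
    proof (rule nn_integral_cong)
      fix x assume x: "x \<in> space (PiM I M)"
      then have "indicator (Pi\<^sub>E I A) x = (\<Prod>i\<in>I. indicator (A i) (x i) :: ennreal)"
        using I by (auto simp: indicator_def space_PiM PiE_iff intro!: prod_zero[symmetric])
      then show "(\<Prod>i\<in>I. g i (x i)) * indicator (Pi\<^sub>E I A) x
          = (\<Prod>i\<in>I. g i (x i) * indicator (A i) (x i))"
        by (simp add: prod.distrib)
    qed
    also have "\<dots> = (\<Prod>i\<in>I. \<integral>\<^sup>+x. g i x * indicator (A i) x \<partial>M i)"
      using I by (intro M.product_nn_integral_prod) auto
    also have "\<dots> = (\<Prod>i\<in>I. emeasure (density (M i) (g i)) (A i))"
      by (intro prod.cong refl, subst emeasure_density) auto
    finally show "emeasure (density (PiM I M) (\<lambda>x. \<Prod>i\<in>I. g i (x i))) (Pi\<^sub>E I A)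
        = (\<Prod>i\<in>I. emeasure (density (M i) (g i)) (A i))" .
  qed
qed

text \<open>Independence means that the joint law is the product of the marginals. The empty index
  set is treated by hand; it occurs as the history \<open>{1..v - 1}\<close> before a change at time
  1.\<close>

lemma (in prob_space) distr_restrict_indep_vars:
  assumes J: "finite J" and ind: "indep_vars M' X J"
    and D: "\<And>i. i \<in> J \<Longrightarrow> distr M (M' i) (X i) = D i" and D': "\<And>i. prob_space (D i)"
  shows "distr M (PiM J M') (\<lambda>\<omega>. \<lambda>i\<in>J. X i \<omega>) = PiM J D"
proof (cases "J = {}")
  case True
  interpret product_sigma_finite D
    unfolding product_sigma_finite_def by (intro allI prob_space_imp_sigma_finite D')
  show ?thesis
  proof (rule PiM_eqI[OF J])
    show "sets (distr M (PiM J M') (\<lambda>\<omega>. \<lambda>i\<in>J. X i \<omega>)) = sets (PiM J D)"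
      using True by simp (metis D empty_iff sets_PiM_cong)
    fix A
    have "(\<lambda>\<omega>. \<lambda>i\<in>{}. X i \<omega>) -` {\<lambda>x. undefined} \<inter> space M = space M"
      by (auto simp: fun_eq_iff)
    then show "emeasure (distr M (PiM J M') (\<lambda>\<omega>. \<lambda>i\<in>J. X i \<omega>)) (Pi\<^sub>E J A) = (\<Prod>i\<in>J. emeasure (D i) (A i))"
      using True by (subst emeasure_distr) (auto simp: emeasure_space_1 sets_PiM_empty intro!: measurable_restrict)
  qed
next
  case False
  have "distr M (PiM J M') (\<lambda>\<omega>. \<lambda>i\<in>J. X i \<omega>) = (\<Pi>\<^sub>M i\<in>J. distr M (M' i) (X i))"
    using ind False by (subst indep_vars_iff_distr_eq_PiM'[symmetric]) (auto simp: indep_vars_def)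
  also have "\<dots> = PiM J D" using D by (intro PiM_cong) auto
  finally show ?thesis .
qed

subsection \<open>Real asymptotics\<close>

text \<open>Evaluates the mean drift over a window of m observations from the change on. Truncated
  subtraction makes the second phase empty when the window ends inside the transient.\<close>

lemma sum_two_phases:
  fixes a b :: real
  shows "(\<Sum>k\<in>{v..<v + m}. if k < v + d then a else b) = real (min m d) * a + real (m - d) * b"
proof (induction m)
  case (Suc m)
  then show ?case by (cases "m < d") (auto simp: min_def algebra_simps Suc_diff_le)
qed simp

text \<open>Passes from one bound per \<epsilon> to a single o(1) remainder, by taking for
  \<open>r\<close> the exact relative deficit of \<open>g\<close> below the target. The inequality
  then holds by construction, and the hypotheses force \<open>r\<close> to tend to 0.\<close>

lemma exists_smallo_remainder:
  fixes g :: "real \<Rightarrow> ennreal"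
  assumes B: "0 < B"
    and lower: "\<And>\<epsilon>. 0 < \<epsilon> \<Longrightarrow> \<epsilon> < 1 \<Longrightarrow> \<forall>\<^sub>F \<gamma> in at_top. ennreal (B * ln \<gamma> * (1 - \<epsilon>)) \<le> g \<gamma>"
  shows "\<exists>r\<in>o[at_top](\<lambda>_::real. 1::real). \<forall>\<^sub>F \<gamma> in at_top. ennreal (ln \<gamma> * B * (1 - r \<gamma>)) \<le> g \<gamma>"
proof -
  \<comment> \<open>Capping at the target makes the value finite even where \<open>g\<close> is
    infinite and keeps \<open>r\<close> nonnegative for large \<gamma>, so only an upper bound on
    \<open>r\<close> is left to prove.\<close>
  define u where "u = (\<lambda>\<gamma>. enn2real (min (g \<gamma>) (ennreal (B * ln \<gamma>))))"
  define r where "r = (\<lambda>\<gamma>. 1 - u \<gamma> / (B * ln \<gamma>))"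
  have u: "ennreal (u \<gamma>) = min (g \<gamma>) (ennreal (B * ln \<gamma>))" for \<gamma>
    unfolding u_def by (intro ennreal_enn2real) (auto simp: min_less_iff_disj)
  have x: "0 < B * ln \<gamma>" if "1 < \<gamma>" for \<gamma> :: real using B that by simp
  have low: "ennreal (ln \<gamma> * B * (1 - r \<gamma>)) \<le> g \<gamma>" if "1 < \<gamma>" for \<gamma>
  proof -
    have "ln \<gamma> * B * (1 - r \<gamma>) = u \<gamma>"
      using B that by (simp add: r_def)
    then show ?thesis by (simp add: u)
  qed
  have ev: "\<forall>\<^sub>F \<gamma> in at_top. ennreal (ln \<gamma> * B * (1 - r \<gamma>)) \<le> g \<gamma>"
    using eventually_gt_at_top[of "1::real"] by (rule eventually_mono) (rule low)
  have "(r \<longlongrightarrow> 0) at_top"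
  proof (rule tendstoI)
    fix e :: real assume "0 < e"
    define \<epsilon> where "\<epsilon> = min (e / 2) (1 / 2)"
    have \<epsilon>: "0 < \<epsilon>" "\<epsilon> < 1" "\<epsilon> < e" using \<open>0 < e\<close> by (auto simp: \<epsilon>_def)
    show "\<forall>\<^sub>F \<gamma> in at_top. dist (r \<gamma>) 0 < e"
      using lower[OF \<epsilon>(1,2)] eventually_gt_at_top[of "1::real"]
    proof eventually_elim
      case (elim \<gamma>)
      have "ennreal (u \<gamma>) \<le> ennreal (B * ln \<gamma>)" unfolding u by simp
      then have 1: "u \<gamma> \<le> B * ln \<gamma>" using x[OF elim(2)] by (subst (asm) ennreal_le_iff) auto
      have "B * ln \<gamma> * (1 - \<epsilon>) \<le> B * ln \<gamma> * 1"
        using x[OF elim(2)] \<epsilon> by (intro mult_left_mono) auto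
      then have "ennreal (B * ln \<gamma> * (1 - \<epsilon>)) \<le> ennreal (u \<gamma>)"
        unfolding u using elim(1) by (auto intro: ennreal_leI)
      then have 2: "B * ln \<gamma> * (1 - \<epsilon>) \<le> u \<gamma>"
        by (subst (asm) ennreal_le_iff) (auto simp: u_def)
      have "u \<gamma> / (B * ln \<gamma>) \<le> 1"
        using 1 x[OF elim(2)] by (simp only: divide_le_eq_1_pos)
      moreover have "1 - \<epsilon> \<le> u \<gamma> / (B * ln \<gamma>)"
        using 2 by (simp only: pos_le_divide_eq[OF x[OF elim(2)]] mult.commute)
      ultimately have "0 \<le> r \<gamma>" "r \<gamma> \<le> \<epsilon>"
        unfolding r_def by linarith+
      then show ?case using \<epsilon> by simp
    qed
  qed
  then have "r \<in> o[at_top](\<lambda>_. 1)" by (intro smalloI_tendsto) auto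
  with ev show ?thesis by blast
qed

text \<open>With x for log \<gamma>, the subtracted terms are the losses from rounding the window
  length, from the change of measure, and from the linear and square-root parts of the weak law.
  After division by x the right side tends to \<beta> (1 - \<epsilon>/2), strictly above \<beta> (1
  - \<epsilon>).\<close>

lemma window_asymptotics:
  fixes \<alpha> \<beta> \<epsilon> C :: real
  assumes "\<alpha> < 1" "0 < \<beta>" "0 < \<epsilon>"
  shows "\<forall>\<^sub>F x in at_top. \<beta> * x * (1 - \<epsilon>)
    \<le> (\<beta> * x - 1) * (1 - 2 * \<beta> * x * exp (- ((1 - \<alpha>) * x)) - \<epsilon> / 2 - C / sqrt x)"
proof -
  define \<delta> where "\<delta> = 1 - \<alpha>"
  have "0 < \<delta>" using assms by (simp add: \<delta>_def)
  then have "((\<lambda>x. (\<beta> - 1 / x) * (1 - 2 * \<beta> * x * exp (- (\<delta> * x)) - \<epsilon> / 2 - C / sqrt x)) \<longlongrightarrow>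
      (\<beta> - 0) * (1 - 0 - \<epsilon> / 2 - 0)) at_top"
    by (intro tendsto_intros; real_asymp)
  then have "\<forall>\<^sub>F x in at_top. \<beta> * (1 - \<epsilon>) < (\<beta> - 1 / x) * (1 - 2 * \<beta> * x * exp (- (\<delta> * x)) - \<epsilon> / 2 - C / sqrt x)"
    by (rule order_tendstoD) (use assms in simp)
  then show ?thesis
    using eventually_gt_at_top[of "0::real"]
  proof eventually_elim
    case (elim x)
    then have "\<beta> * (1 - \<epsilon>) * x \<le> (\<beta> - 1 / x) * (1 - 2 * \<beta> * x * exp (- (\<delta> * x)) - \<epsilon> / 2 - C / sqrt x) * x"
      by (intro mult_right_mono) auto
    also have "\<dots> = ((\<beta> - 1 / x) * x) * (1 - 2 * \<beta> * x * exp (- (\<delta> * x)) - \<epsilon> / 2 - C / sqrt x)"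
      by (simp only: mult_ac)
    also have "(\<beta> - 1 / x) * x = \<beta> * x - 1" using elim by (simp add: field_simps)
    finally show ?case by (simp add: \<delta>_def mult_ac)
  qed
qed

subsection \<open>The change-point model\<close>

context transient_change_model
begin

abbreviation F where "F \<equiv> obs_filtration (space Pinf) \<mu> X"
abbreviation I1 where "I1 \<equiv> KL_info \<mu> f1 f0"
abbreviation I2 where "I2 \<equiv> KL_info \<mu> f2 f0"

definition llr :: "nat \<Rightarrow> nat \<Rightarrow> nat \<Rightarrow> 'a \<Rightarrow> real" where
  "llr d v k x = ln (regime f0 f1 f2 d v k x / f0 x)"

definition LLR :: "nat \<Rightarrow> nat \<Rightarrow> nat \<Rightarrow> 'w \<Rightarrow> real" where
  "LLR d v n \<omega> = (\<Sum>k\<in>{v..n}. llr d v k (X k \<omega>))"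

text \<open>Set to \<open>1\<close> before the change, where \<open>f0 x / f0 x\<close> would be \<open>0\<close> on the \<open>Pinf\<close>-null set \<open>f0 x = 0\<close>.\<close>

definition ratio :: "nat \<Rightarrow> nat \<Rightarrow> nat \<Rightarrow> 'a \<Rightarrow> real" where
  "ratio d v k x = (if k < v then 1 else regime f0 f1 f2 d v k x / f0 x)"

section \<open>One-step densities and likelihood ratios\<close>

lemma f_measurable [measurable]:
  "f0 \<in> borel_measurable \<mu>" "f1 \<in> borel_measurable \<mu>" "f2 \<in> borel_measurable \<mu>"
  using dens by (auto simp: prob_dens_def)

lemma f_nonneg: "x \<in> space \<mu> \<Longrightarrow> 0 \<le> f0 x" "x \<in> space \<mu> \<Longrightarrow> 0 \<le> f1 x" "x \<in> space \<mu> \<Longrightarrow> 0 \<le> f2 x"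
  using dens by (auto simp: prob_dens_def)

lemma regime_measurable [measurable]: "regime f0 f1 f2 d v k \<in> borel_measurable \<mu>"
  by (simp add: regime_def)

lemma regime_nonneg: "x \<in> space \<mu> \<Longrightarrow> 0 \<le> regime f0 f1 f2 d v k x"
  by (simp add: regime_def f_nonneg)

lemma llr_measurable [measurable]: "llr d v k \<in> borel_measurable \<mu>"
  unfolding llr_def[abs_def] by measurable

lemma ratio_measurable [measurable]: "ratio d v k \<in> borel_measurable \<mu>"
  unfolding ratio_def[abs_def] by measurable

lemma ratio_nonneg: "x \<in> space \<mu> \<Longrightarrow> 0 \<le> ratio d v k x"
  by (simp add: ratio_def regime_nonneg f_nonneg)

lemma prob_space_regime: "prob_space (density \<mu> (\<lambda>x. ennreal (regime f0 f1 f2 d v k x)))"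
  using dens by (intro prob_spaceI) (auto simp: regime_def prob_dens_def emeasure_density
      intro!: trans[OF nn_integral_cong])

lemma prob_space_f0: "prob_space (density \<mu> (\<lambda>x. ennreal (f0 x)))"
  using prob_space_regime[of 0 1 0] by (simp add: regime_def)

text \<open>On the set where \<open>f0\<close> vanishes, finite information forces \<open>f1\<close>
  and \<open>f2\<close> to vanish almost everywhere, so the default value of division by 0 does no
  harm.\<close>

lemma density_regime:
  "density \<mu> (\<lambda>x. ennreal (regime f0 f1 f2 d v k x))
    = density (density \<mu> (\<lambda>x. ennreal (f0 x))) (\<lambda>x. ennreal (ratio d v k x))"
proof (subst density_density_eq, simp, simp, rule density_cong)
  have "AE x in \<mu>. f0 x = 0 \<longrightarrow> f1 x = 0" "AE x in \<mu>. f0 x = 0 \<longrightarrow> f2 x = 0"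
    using info_finite by (auto simp: KL_finite_def)
  then show "AE x in \<mu>. ennreal (regime f0 f1 f2 d v k x) = ennreal (f0 x) * ennreal (ratio d v k x)"
    using AE_space
    by eventually_elim (auto simp: ratio_def regime_def ennreal_mult'[symmetric] f_nonneg)
qed auto

section \<open>The observed filtration and joint laws of finitely many observations\<close>

lemma X_measurable [measurable]: "1 \<le> k \<Longrightarrow> X k \<in> measurable Pinf \<mu>"
  using distr_inf by (simp add: distributed_def)

lemma space_P: "1 \<le> v \<Longrightarrow> space (P d v) = space Pinf"
  using sets_P by (rule sets_eq_imp_space_eq)

lemma X_measurable_P: "1 \<le> v \<Longrightarrow> 1 \<le> k \<Longrightarrow> X k \<in> measurable (P d v) \<mu>"
  using X_measurable measurable_cong_sets[OF sets_P refl] by blast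

lemma space_F [simp]: "space (F t) = space Pinf"
  unfolding obs_filtration_def by (intro space_measure_of) auto

lemma sets_F: "sets (F t) = sigma_sets (space Pinf)
    {X k -` A \<inter> space Pinf | k A. 1 \<le> k \<and> enat k \<le> t \<and> A \<in> sets \<mu>}"
  unfolding obs_filtration_def by (intro sets_measure_of) auto

lemma sets_F_subset: "sets (F t) \<subseteq> sets Pinf"
  unfolding sets_F by (intro sets.sigma_sets_subset) (auto intro!: measurable_sets X_measurable)

lemma sets_F_mono: "s \<le> t \<Longrightarrow> sets (F s) \<subseteq> sets (F t)"
  unfolding sets_F by (intro sigma_sets_mono') (auto intro: order_trans)

lemma restrict_X_measurable:
  "J \<subseteq> {1..} \<Longrightarrow> (\<lambda>\<omega>. \<lambda>k\<in>J. X k \<omega>) \<in> measurable Pinf (PiM J (\<lambda>_. \<mu>))"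
  by (intro measurable_restrict X_measurable) auto

text \<open>The generators of the filtration at time n are preimages under the vector of the first n
  observations, and all preimages of measurable sets under that vector already form a
  sigma-algebra.\<close>

lemma F_factorization:
  assumes "A \<in> sets (F (enat n))"
  obtains B where "B \<in> sets (PiM {1..n} (\<lambda>_. \<mu>))"
    "A = (\<lambda>\<omega>. \<lambda>k\<in>{1..n}. X k \<omega>) -` B \<inter> space Pinf"
proof -
  define R where "R = (\<lambda>\<omega>. \<lambda>k\<in>{1..n}. X k \<omega>)"
  have R: "R \<in> space Pinf \<rightarrow> space (PiM {1..n} (\<lambda>_. \<mu>))"
    unfolding R_def using measurable_space[OF restrict_X_measurable[of "{1..n}"]] by auto
  define V where "V = vimage_algebra (space Pinf) R (PiM {1..n} (\<lambda>_. \<mu>))"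
  have RV: "R \<in> measurable V (PiM {1..n} (\<lambda>_. \<mu>))"
    unfolding V_def using R by (rule measurable_vimage_algebra1)
  have V: "space V = space Pinf" by (simp add: V_def)
  have "{X k -` C \<inter> space Pinf | k C. 1 \<le> k \<and> enat k \<le> enat n \<and> C \<in> sets \<mu>} \<subseteq> sets V"
  proof safe
    fix k C assume k: "1 \<le> k" "enat k \<le> enat n" and C: "C \<in> sets \<mu>"
    have "(\<lambda>\<omega>. R \<omega> k) \<in> measurable V \<mu>"
      using k by (intro measurable_compose[OF RV] measurable_component_singleton) auto
    from measurable_sets[OF this C] k
    show "X k -` C \<inter> space Pinf \<in> sets V"
      by (simp add: R_def V)
  qed
  from sets.sigma_sets_subset[OF this] have "A \<in> sets V"
    using assms by (auto simp: V sets_F)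
  then show ?thesis
    using that R unfolding R_def V_def by (auto simp: sets_vimage_algebra2)
qed

text \<open>Both joint laws are products, and coordinate by coordinate one has density
  \<open>ratio\<close> with respect to the other; \<open>density_PiM\<close> multiplies these
  densities.\<close>

lemma joint_density:
  assumes v: "1 \<le> v"
  shows "distr (P d v) (PiM {1..n} (\<lambda>_. \<mu>)) (\<lambda>\<omega>. \<lambda>k\<in>{1..n}. X k \<omega>)
    = density (distr Pinf (PiM {1..n} (\<lambda>_. \<mu>)) (\<lambda>\<omega>. \<lambda>k\<in>{1..n}. X k \<omega>))
        (\<lambda>x. \<Prod>k\<in>{1..n}. ennreal (ratio d v k (x k)))"
proof -
  interpret Q: prob_space "P d v" using v by (rule prob_P)
  interpret Pinf: prob_space Pinf by (rule prob_inf)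
  have "distr (P d v) (PiM {1..n} (\<lambda>_. \<mu>)) (\<lambda>\<omega>. \<lambda>k\<in>{1..n}. X k \<omega>)
      = PiM {1..n} (\<lambda>k. density \<mu> (\<lambda>x. ennreal (regime f0 f1 f2 d v k x)))"
    using v distr_P[OF v]
    by (intro Q.distr_restrict_indep_vars Q.indep_vars_subset[OF indep_P[OF v]] prob_space_regime)
      (auto simp: distributed_def)
  also have "\<dots> = PiM {1..n} (\<lambda>k. density (density \<mu> (\<lambda>x. ennreal (f0 x))) (\<lambda>x. ennreal (ratio d v k x)))"
    by (simp only: density_regime)
  also have "\<dots> = density (PiM {1..n} (\<lambda>_. density \<mu> (\<lambda>x. ennreal (f0 x))))
      (\<lambda>x. \<Prod>k\<in>{1..n}. ennreal (ratio d v k (x k)))"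
    by (intro density_PiM prob_space_imp_sigma_finite prob_space_f0)
      (auto simp: density_regime[symmetric] intro: prob_space_regime)
  also have "PiM {1..n} (\<lambda>_. density \<mu> (\<lambda>x. ennreal (f0 x)))
      = distr Pinf (PiM {1..n} (\<lambda>_. \<mu>)) (\<lambda>\<omega>. \<lambda>k\<in>{1..n}. X k \<omega>)"
    using distr_inf
    by (intro Pinf.distr_restrict_indep_vars[symmetric] Pinf.indep_vars_subset[OF indep_inf] prob_space_f0)
      (auto simp: distributed_def)
  finally show ?thesis .
qed

lemma emeasure_P_eq:
  assumes v: "1 \<le> v" and B [measurable]: "B \<in> sets (PiM {1..n} (\<lambda>_. \<mu>))"
  shows "emeasure (P d v) ((\<lambda>\<omega>. \<lambda>k\<in>{1..n}. X k \<omega>) -` B \<inter> space Pinf)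
    = (\<integral>\<^sup>+x. (\<Prod>k\<in>{1..n}. ennreal (ratio d v k (x k))) * indicator B x
        \<partial>distr Pinf (PiM {1..n} (\<lambda>_. \<mu>)) (\<lambda>\<omega>. \<lambda>k\<in>{1..n}. X k \<omega>))"
proof -
  have R: "(\<lambda>\<omega>. \<lambda>k\<in>{1..n}. X k \<omega>) \<in> measurable (P d v) (PiM {1..n} (\<lambda>_. \<mu>))"
    using v by (intro measurable_restrict X_measurable_P) auto
  have "emeasure (P d v) ((\<lambda>\<omega>. \<lambda>k\<in>{1..n}. X k \<omega>) -` B \<inter> space Pinf)
      = emeasure (distr (P d v) (PiM {1..n} (\<lambda>_. \<mu>)) (\<lambda>\<omega>. \<lambda>k\<in>{1..n}. X k \<omega>)) B"
    by (simp only: emeasure_distr[OF R B] space_P[OF v])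
  also have "\<dots> = (\<integral>\<^sup>+x. (\<Prod>k\<in>{1..n}. ennreal (ratio d v k (x k))) * indicator B x
        \<partial>distr Pinf (PiM {1..n} (\<lambda>_. \<mu>)) (\<lambda>\<omega>. \<lambda>k\<in>{1..n}. X k \<omega>))"
    unfolding joint_density[OF v] using B by (intro emeasure_density) (auto simp del: One_nat_def)
  finally show ?thesis .
qed

text \<open>Every factor of the likelihood ratio up to time v - 1 equals 1.\<close>

lemma prob_P_before_change:
  assumes v: "1 \<le> v" and A: "A \<in> sets (F (enat (v - 1)))"
  shows "measure (P d v) A = measure Pinf A"
proof -
  obtain B where B [measurable]: "B \<in> sets (PiM {1..v - 1} (\<lambda>_. \<mu>))"
    and AB: "A = (\<lambda>\<omega>. \<lambda>k\<in>{1..v - 1}. X k \<omega>) -` B \<inter> space Pinf"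
    using A by (rule F_factorization)
  have "(\<Prod>k\<in>{1..v - 1}. ennreal (ratio d v k (x k))) = 1" for x :: "nat \<Rightarrow> 'a"
    using v by (intro prod.neutral) (auto simp: ratio_def)
  then have "emeasure (P d v) A = emeasure (distr Pinf (PiM {1..v - 1} (\<lambda>_. \<mu>)) (\<lambda>\<omega>. \<lambda>k\<in>{1..v - 1}. X k \<omega>)) B"
    unfolding AB emeasure_P_eq[OF v B] using B by (simp del: One_nat_def)
  also have "\<dots> = emeasure Pinf A"
    unfolding AB by (intro emeasure_distr restrict_X_measurable B) auto
  finally show ?thesis by (simp add: measure_def)
qed

section \<open>Change of measure and independence from the past\<close>

lemma LLR_measurable: "1 \<le> v \<Longrightarrow> LLR d v n \<in> borel_measurable Pinf"
  unfolding LLR_def by (intro borel_measurable_sum measurable_compose[OF X_measurable]) auto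

text \<open>\<open>A\<close> is split by whether the likelihood ratio is at most
  \<open>exp a\<close>. On the first part integrating the ratio costs at most that factor; on the
  second the log-likelihood ratio exceeds a.\<close>

lemma prob_P_le_change_of_measure:
  assumes v: "1 \<le> v" and A: "A \<in> sets (F (enat n))"
  shows "measure (P d v) A \<le> exp a * measure Pinf A + measure (P d v) {\<omega> \<in> A. a < LLR d v n \<omega>}"
proof -
  interpret Q: prob_space "P d v" using v by (rule prob_P)
  interpret Pinf: prob_space Pinf by (rule prob_inf)
  define R where "R = (\<lambda>\<omega>. \<lambda>k\<in>{1..n}. X k \<omega>)"
  obtain B where B [measurable]: "B \<in> sets (PiM {1..n} (\<lambda>_. \<mu>))" and AB: "A = R -` B \<inter> space Pinf"
    using A unfolding R_def by (rule F_factorization)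
  have R [measurable]: "R \<in> measurable Pinf (PiM {1..n} (\<lambda>_. \<mu>))"
    unfolding R_def by (rule restrict_X_measurable) auto
  define B' where "B' = {x \<in> space (PiM {1..n} (\<lambda>_. \<mu>)). x \<in> B \<and> (\<Prod>k\<in>{1..n}. ratio d v k (x k)) \<le> exp a}"
  have B' [measurable]: "B' \<in> sets (PiM {1..n} (\<lambda>_. \<mu>))" unfolding B'_def by measurable
  define A' where "A' = R -` B' \<inter> space Pinf"
  have A' [measurable]: "A' \<in> sets Pinf" unfolding A'_def by measurable
  have Am [measurable]: "A \<in> sets Pinf" unfolding AB by measurable
  have "emeasure (P d v) A' = (\<integral>\<^sup>+x. (\<Prod>k\<in>{1..n}. ennreal (ratio d v k (x k))) * indicator B' x
      \<partial>distr Pinf (PiM {1..n} (\<lambda>_. \<mu>)) R)"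
    unfolding A'_def R_def by (rule emeasure_P_eq[OF v B'])
  also have "\<dots> \<le> (\<integral>\<^sup>+x. ennreal (exp a) * indicator B' x \<partial>distr Pinf (PiM {1..n} (\<lambda>_. \<mu>)) R)"
  proof (rule nn_integral_mono)
    fix x assume "x \<in> space (distr Pinf (PiM {1..n} (\<lambda>_. \<mu>)) R)"
    then have x: "x \<in> space (PiM {1..n} (\<lambda>_. \<mu>))" by simp
    then have "(\<Prod>k\<in>{1..n}. ennreal (ratio d v k (x k))) = ennreal (\<Prod>k\<in>{1..n}. ratio d v k (x k))"
      by (intro prod_ennreal ratio_nonneg) (auto simp: space_PiM)
    then show "(\<Prod>k\<in>{1..n}. ennreal (ratio d v k (x k))) * indicator B' x \<le> ennreal (exp a) * indicator B' x"
      by (auto simp: B'_def indicator_def intro: ennreal_leI)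
  qed
  also have "\<dots> = ennreal (exp a) * emeasure Pinf A'"
    unfolding A'_def by (subst nn_integral_cmult_indicator) (auto simp: emeasure_distr simp del: One_nat_def)
  also have "\<dots> \<le> ennreal (exp a) * emeasure Pinf A"
    by (intro mult_left_mono emeasure_mono) (auto simp: A'_def AB B'_def)
  finally have "measure (P d v) A' \<le> exp a * measure Pinf A"
    unfolding Q.emeasure_eq_measure Pinf.emeasure_eq_measure
    by (simp add: ennreal_mult'[symmetric])
  moreover have "measure (P d v) A \<le> measure (P d v) A' + measure (P d v) {\<omega> \<in> A. a < LLR d v n \<omega>}"
  proof -
    have sub: "A \<subseteq> A' \<union> {\<omega> \<in> A. a < LLR d v n \<omega>}"
    proof
      fix \<omega> assume \<omega>: "\<omega> \<in> A"
      then have \<omega>s: "\<omega> \<in> space Pinf" by (simp add: AB)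
      show "\<omega> \<in> A' \<union> {\<omega> \<in> A. a < LLR d v n \<omega>}"
      proof (cases "(\<Prod>k\<in>{1..n}. ratio d v k (X k \<omega>)) \<le> exp a")
        case True
        moreover have "R \<omega> \<in> space (PiM {1..n} (\<lambda>_. \<mu>))" using measurable_space[OF R \<omega>s] .
        ultimately show ?thesis using \<omega> by (simp add: A'_def B'_def AB R_def)
      next
        \<comment> \<open>The product exceeds \<open>exp a\<close>, so no factor is 0 and the
          logarithm splits into a sum; the default \<open>ln 0 = 0\<close> would break this. Paths
          with a zero factor have product 0 and were caught by \<open>A'\<close>.\<close>
        case False
        have rn: "0 \<le> ratio d v k (X k \<omega>)" if "k \<in> {1..n}" for k
          using that \<omega>s by (intro ratio_nonneg measurable_space[OF X_measurable]) auto
        have "(\<Prod>k\<in>{1..n}. ratio d v k (X k \<omega>)) \<noteq> 0"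
          using False exp_gt_zero[of a] by linarith
        then have nz: "\<forall>k\<in>{1..n}. ratio d v k (X k \<omega>) \<noteq> 0" by simp
        with rn have pos: "0 < ratio d v k (X k \<omega>)" if "k \<in> {1..n}" for k
          using that by fastforce
        have "0 < (\<Prod>k\<in>{1..n}. ratio d v k (X k \<omega>))"
          using pos by (intro prod_pos)
        then have "ln (exp a) < ln (\<Prod>k\<in>{1..n}. ratio d v k (X k \<omega>))"
          using False by (subst ln_less_cancel_iff) (simp_all only: exp_gt_zero not_le)
        also have "\<dots> = (\<Sum>k\<in>{1..n}. ln (ratio d v k (X k \<omega>)))"
          by (intro ln_prod finite_atLeastAtMost) (rule nz[rule_format])
        also have "\<dots> = LLR d v n \<omega>"
          \<comment> \<open>The factors before \<open>v\<close> are 1 and contribute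
            \<open>ln 1 = 0\<close>.\<close>
          unfolding LLR_def using v
          by (intro sum.mono_neutral_cong_right) (auto simp: ratio_def llr_def)
        finally show ?thesis using \<omega> by simp
      qed
    qed
    note LLR_measurable[OF v, measurable]
    have "{\<omega> \<in> A. a < LLR d v n \<omega>} = A \<inter> {\<omega> \<in> space Pinf. a < LLR d v n \<omega>}" by (auto simp: AB)
    also have "\<dots> \<in> sets Pinf" by measurable
    finally have "{\<omega> \<in> A. a < LLR d v n \<omega>} \<in> sets (P d v)" "A' \<in> sets (P d v)"
      using v A' by (auto simp: sets_P)
    then show ?thesis
      by (intro order_trans[OF Q.finite_measure_mono[OF sub] measure_Un_le]) auto
  qed
  ultimately show ?thesis by linarith
qed

text \<open>\<open>A\<close> is a function of the observations before \<open>v\<close>, the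
  log-likelihood ratio of those from \<open>v\<close> on, and disjoint blocks of independent
  variables are independent.\<close>

lemma prob_P_indep_LLR:
  assumes v: "1 \<le> v" and A: "A \<in> sets (F (enat (v - 1)))"
  shows "measure (P d v) {\<omega> \<in> A. a < LLR d v n \<omega>}
    = measure (P d v) A * measure (P d v) {\<omega> \<in> space Pinf. a < LLR d v n \<omega>}"
proof -
  interpret Q: prob_space "P d v" using v by (rule prob_P)
  obtain B where B: "B \<in> sets (PiM {1..v - 1} (\<lambda>_. \<mu>))"
    and AB: "A = (\<lambda>\<omega>. \<lambda>k\<in>{1..v - 1}. X k \<omega>) -` B \<inter> space Pinf"
    using A by (rule F_factorization)
  define C where "C = {x \<in> space (PiM {v..n} (\<lambda>_. \<mu>)). a < (\<Sum>k\<in>{v..n}. llr d v k (x k))}"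
  have C: "C \<in> sets (PiM {v..n} (\<lambda>_. \<mu>))" unfolding C_def by measurable
  have iff: "(\<lambda>k\<in>{v..n}. X k \<omega>) \<in> C \<longleftrightarrow> a < LLR d v n \<omega>" if "\<omega> \<in> space Pinf" for \<omega>
    using that v measurable_space[OF restrict_X_measurable[of "{v..n}"], of \<omega>]
    by (auto simp: C_def LLR_def)
  have "Q.indep_var (PiM {1..v - 1} (\<lambda>_. \<mu>)) (\<lambda>\<omega>. \<lambda>k\<in>{1..v - 1}. X k \<omega>)
      (PiM {v..n} (\<lambda>_. \<mu>)) (\<lambda>\<omega>. \<lambda>k\<in>{v..n}. X k \<omega>)"
    using v by (intro Q.indep_var_restrict[OF indep_P[OF v]]) auto
  note ind = Q.indep_varD[OF this B C]
  have 1: "(\<lambda>\<omega>. (\<lambda>k\<in>{1..v - 1}. X k \<omega>, \<lambda>k\<in>{v..n}. X k \<omega>)) -` (B \<times> C) \<inter> space (P d v)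
      = {\<omega> \<in> A. a < LLR d v n \<omega>}"
    unfolding AB space_P[OF v] using iff by blast
  have 2: "(\<lambda>\<omega>. \<lambda>k\<in>{v..n}. X k \<omega>) -` C \<inter> space (P d v) = {\<omega> \<in> space Pinf. a < LLR d v n \<omega>}"
    unfolding space_P[OF v] using iff by blast
  have 3: "(\<lambda>\<omega>. \<lambda>k\<in>{1..v - 1}. X k \<omega>) -` B \<inter> space (P d v) = A"
    unfolding AB space_P[OF v] ..
  show ?thesis using ind unfolding 1 2 3 .
qed


section \<open>Stopping times and the comparison of the two delays\<close>

lemma stopping_time_le_sets:
  "stopping_time F \<tau> \<Longrightarrow> {\<omega> \<in> space Pinf. \<tau> \<omega> \<le> t} \<in> sets (F t)"
  using stopping_timeD[of F \<tau> t] by (simp add: pred_def)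

text \<open>Reaching \<open>v\<close> is the complement of having stopped by v - 1, so the
  conditioning event of the Pollak delay is decided strictly before the change.\<close>

lemma stopping_time_ge_sets:
  assumes "stopping_time F \<tau>" "1 \<le> v"
  shows "{\<omega> \<in> space Pinf. enat v \<le> \<tau> \<omega>} \<in> sets (F (enat (v - 1)))"
proof -
  have iff: "enat v \<le> t \<longleftrightarrow> \<not> t \<le> enat (v - 1)" for t
    using assms(2) by (cases t) auto
  have "{\<omega> \<in> space Pinf. enat v \<le> \<tau> \<omega>} = space (F (enat (v - 1))) - {\<omega> \<in> space Pinf. \<tau> \<omega> \<le> enat (v - 1)}"
    using iff by auto
  then show ?thesis
    using sets.compl_sets[OF stopping_time_le_sets[OF assms(1), of "enat (v - 1)"]] by simp
qed

lemma stopping_time_measurable: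
  assumes "stopping_time F \<tau>"
  shows "\<tau> \<in> measurable Pinf (count_space UNIV)"
proof -
  have ge: "{\<omega> \<in> space Pinf. enat v \<le> \<tau> \<omega>} \<in> sets Pinf" for v
    using stopping_time_ge_sets[OF assms, of v] sets_F_subset
    by (cases "v = 0") (auto simp: enat_0 simp del: One_nat_def)
  have "\<tau> -` {t} \<inter> space Pinf \<in> sets Pinf" for t
  proof (cases t)
    case (enat n)
    have "\<tau> -` {t} \<inter> space Pinf = {\<omega> \<in> space Pinf. enat n \<le> \<tau> \<omega>} - {\<omega> \<in> space Pinf. enat (Suc n) \<le> \<tau> \<omega>}"
      by (auto simp: enat Suc_ile_eq)
    then show ?thesis using ge by auto
  next
    case infinity
    have "\<tau> -` {t} \<inter> space Pinf = (\<Inter>n. {\<omega> \<in> space Pinf. enat n \<le> \<tau> \<omega>})"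
    proof safe
      fix \<omega> assume "\<omega> \<in> (\<Inter>n. {\<omega> \<in> space Pinf. enat n \<le> \<tau> \<omega>})"
      then have all: "enat n \<le> \<tau> \<omega>" for n by auto
      have "\<tau> \<omega> = \<infinity>"
      proof (cases "\<tau> \<omega>")
        case (enat n)
        then show ?thesis using all[of "Suc n"] by simp
      qed
      then show "\<omega> \<in> \<tau> -` {t}" by (simp add: infinity)
    qed (auto simp: infinity)
    then show ?thesis using ge by auto
  qed
  then show ?thesis by (subst measurable_count_space_eq2_countable) auto
qed

lemma measurable_P_iff: "1 \<le> v \<Longrightarrow> measurable (P d v) N = measurable Pinf N"
  by (intro measurable_cong_sets sets_P refl)

text \<open>Since the event \<tau> \<ge> v is known at time v - 1, the Pollak delay at
  \<open>v\<close> is an average over it of the conditional expected delay, and an average is at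
  most the essential supremum.\<close>

lemma pollak_le_lorden:
  assumes \<tau>: "stopping_time F \<tau>"
  shows "pollak_delay (P d) \<tau> \<le> lorden_delay (P d) F \<tau>"
  unfolding pollak_delay_def lorden_delay_def
proof (rule SUP_mono, rule bexI)
  fix v :: nat assume v': "v \<in> {1..}"
  then have v: "1 \<le> v" by simp
  show "v \<in> {1..}" by fact
  interpret Q: prob_space "P d v" using v by (rule prob_P)
  interpret S: finite_measure_subalgebra "P d v" "F (enat (v - 1))"
    by standard (use sets_F_subset v in \<open>auto simp: subalgebra_def space_P sets_P\<close>)
  define A where "A = {\<omega> \<in> space (P d v). enat v \<le> \<tau> \<omega>}"
  define D where "D = (\<lambda>\<omega>. ennreal_of_enat (\<tau> \<omega> - enat v))"
  define e where "e = esssup (P d v) (nn_cond_exp (P d v) (F (enat (v - 1))) D)"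
  have AF: "A \<in> sets (F (enat (v - 1)))"
    unfolding A_def space_P[OF v] using \<tau> v by (rule stopping_time_ge_sets)
  then have A [measurable]: "A \<in> sets (P d v)" using sets_F_subset v by (auto simp: sets_P)
  have "\<tau> \<in> measurable (P d v) (count_space UNIV)"
    using stopping_time_measurable[OF \<tau>] v by (simp add: measurable_P_iff)
  then have D [measurable]: "D \<in> borel_measurable (P d v)"
    unfolding D_def by (rule measurable_compose) simp
  have "(\<integral>\<^sup>+\<omega>. D \<omega> \<partial>uniform_measure (P d v) A) = (\<integral>\<^sup>+\<omega>. indicator A \<omega> * D \<omega> \<partial>P d v) / emeasure (P d v) A"
    by (subst nn_integral_uniform_measure) (auto simp: mult.commute)
  also have "\<dots> \<le> e"
  proof (cases "emeasure (P d v) A = 0")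
    \<comment> \<open>With a null conditioning event both numerator and denominator are 0, and the
      quotient is 0 in \<open>ennreal\<close>.\<close>
    case True
    then have "AE \<omega> in P d v. \<omega> \<notin> A" using A by (intro AE_not_in) auto
    then have "(\<integral>\<^sup>+\<omega>. indicator A \<omega> * D \<omega> \<partial>P d v) = (\<integral>\<^sup>+\<omega>. 0 \<partial>P d v)"
      by (intro nn_integral_cong_AE) auto
    then show ?thesis by simp
  next
    case False
    have "(\<integral>\<^sup>+\<omega>. indicator A \<omega> * D \<omega> \<partial>P d v)
        = (\<integral>\<^sup>+\<omega>. indicator A \<omega> * nn_cond_exp (P d v) (F (enat (v - 1))) D \<omega> \<partial>P d v)"
      using AF by (intro S.nn_cond_exp_intg[symmetric]) auto
    also have "\<dots> \<le> (\<integral>\<^sup>+\<omega>. e * indicator A \<omega> \<partial>P d v)"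
    proof (rule nn_integral_mono_AE)
      show "AE \<omega> in P d v. indicator A \<omega> * nn_cond_exp (P d v) (F (enat (v - 1))) D \<omega> \<le> e * indicator A \<omega>"
        using esssup_AE[where M = "P d v" and f = "nn_cond_exp (P d v) (F (enat (v - 1))) D"]
        by eventually_elim (auto simp: e_def indicator_def)
    qed
    also have "\<dots> = emeasure (P d v) A * e" by (simp add: nn_integral_cmult_indicator mult.commute)
    finally show ?thesis using False by (intro divide_le_posI_ennreal) (auto simp: zero_less_iff_neq_zero)
  qed
  finally show "(\<integral>\<^sup>+\<omega>. ennreal_of_enat (\<tau> \<omega> - enat v) \<partial>uniform_measure (P d v) {\<omega> \<in> space (P d v). enat v \<le> \<tau> \<omega>})
      \<le> esssup (P d v) (nn_cond_exp (P d v) (F (enat (v - 1))) (\<lambda>\<omega>. ennreal_of_enat (\<tau> \<omega> - enat v)))"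
    unfolding A_def D_def e_def .
qed

section \<open>Deviations of the log-likelihood ratio over a window\<close>

definition mean_LLR :: "nat \<Rightarrow> nat \<Rightarrow> real" where
  "mean_LLR d m = real (min m d) * I1 + real (m - d) * I2"

text \<open>\<open>mean_LLR d m\<close> is the expectation under \<open>P d v\<close> of the ratio
  over m observations from \<open>v\<close> on, whatever \<open>v\<close> is. Truncating the
  summands at a level fixed by \<eta> alone gives a bound uniform in the change-point, the duration
  and the window length.\<close>

lemma LLR_mean_deviation:
  assumes \<eta>: "0 < \<eta>"
  shows "\<exists>K\<ge>0. \<forall>d v m. 1 \<le> v \<longrightarrow> 1 \<le> m \<longrightarrow> integrable (P d v) (LLR d v (v + m - 1)) \<and>
    (LINT \<omega>|P d v. \<bar>LLR d v (v + m - 1) \<omega> - mean_LLR d m\<bar>) \<le> 2 * \<eta> * real m + 2 * K * sqrt (real m)"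
proof -
  have int: "integrable \<mu> (\<lambda>x. f1 x * ln (f1 x / f0 x))" "integrable \<mu> (\<lambda>x. f2 x * ln (f2 x / f0 x))"
    using info_finite by (auto simp: KL_finite_def)
  obtain k1 where k1: "\<And>k. k1 \<le> k \<Longrightarrow>
      (LINT x|\<mu>. f1 x * \<bar>if \<bar>ln (f1 x / f0 x)\<bar> \<le> real k then 0 else ln (f1 x / f0 x)\<bar>) \<le> \<eta>"
    using truncation_tail_small[OF int(1) _ _ \<eta>] by auto
  obtain k2 where k2: "\<And>k. k2 \<le> k \<Longrightarrow>
      (LINT x|\<mu>. f2 x * \<bar>if \<bar>ln (f2 x / f0 x)\<bar> \<le> real k then 0 else ln (f2 x / f0 x)\<bar>) \<le> \<eta>"
    using truncation_tail_small[OF int(2) _ _ \<eta>] by auto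
  \<comment> \<open>The larger of the two levels makes both tails at most \<eta> in mean.\<close>
  define K where "K = real (max k1 k2)"
  define trunc where "trunc = (\<lambda>y::real. if \<bar>y\<bar> \<le> K then y else 0)"
  define tail where "tail = (\<lambda>y::real. if \<bar>y\<bar> \<le> K then 0 else y)"
  have [measurable]: "trunc \<in> borel_measurable borel" "tail \<in> borel_measurable borel"
    unfolding trunc_def tail_def by measurable
  \<comment> \<open>From \<open>v\<close> on only the laws \<open>f1\<close> and \<open>f2\<close>
    occur, so statements about these two cover every k, d and v.\<close>
  have regime_int: "integrable \<mu> (\<lambda>x. regime f0 f1 f2 d v k x * llr d v k x)"
    and regime_mean: "(LINT x|\<mu>. regime f0 f1 f2 d v k x * llr d v k x) = (if k < v + d then I1 else I2)"
    and regime_tail: "(LINT x|\<mu>. regime f0 f1 f2 d v k x * \<bar>tail (llr d v k x)\<bar>) \<le> \<eta>"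
    if "v \<le> k" for d v k
    using that int k1[of "max k1 k2"] k2[of "max k1 k2"]
    by (auto simp: regime_def llr_def tail_def K_def KL_info_def)
  show ?thesis
  proof (intro exI[of _ K] conjI allI impI)
    show "0 \<le> K" by (simp add: K_def)
    fix d v m :: nat assume v: "1 \<le> v" and m: "1 \<le> m"
    interpret Q: prob_space "P d v" using v by (rule prob_P)
    define J where "J = {v..<v + m}"
    have J: "{v..v + m - 1} = J" using m by (auto simp: J_def)
    have llr_int: "integrable (P d v) (\<lambda>\<omega>. llr d v k (X k \<omega>))"
      and llr_mean: "(LINT \<omega>|P d v. llr d v k (X k \<omega>)) = (if k < v + d then I1 else I2)"
      and tail_small: "(LINT \<omega>|P d v. \<bar>tail (llr d v k (X k \<omega>))\<bar>) \<le> \<eta>" if "k \<in> J" for k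
    proof -
      have k: "v \<le> k" "1 \<le> k" using that v by (auto simp: J_def)
      note D = distr_P[OF v k(2), of d]
      show "integrable (P d v) (\<lambda>\<omega>. llr d v k (X k \<omega>))"
        using regime_int[OF k(1), of d] distributed_integrable[OF D llr_measurable regime_nonneg, of d v k] by simp
      show "(LINT \<omega>|P d v. llr d v k (X k \<omega>)) = (if k < v + d then I1 else I2)"
        using regime_mean[OF k(1), of d] distributed_integral[OF D llr_measurable regime_nonneg, of d v k] by simp
      show "(LINT \<omega>|P d v. \<bar>tail (llr d v k (X k \<omega>))\<bar>) \<le> \<eta>"
        using regime_tail[OF k(1), of d]
          distributed_integral[OF D _ regime_nonneg, of "\<lambda>x. \<bar>tail (llr d v k x)\<bar>"] by simp
    qed
    have Xm [measurable]: "X k \<in> measurable (P d v) \<mu>" if "k \<in> J" for k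
      using that v by (intro X_measurable_P) (auto simp: J_def)
    have split: "llr d v k (X k \<omega>) = trunc (llr d v k (X k \<omega>)) + tail (llr d v k (X k \<omega>))" for k \<omega>
      by (simp add: trunc_def tail_def)
    show "integrable (P d v) (LLR d v (v + m - 1))"
      unfolding LLR_def J using llr_int by auto
    have "Q.expectation (\<lambda>\<omega>. \<bar>(\<Sum>k\<in>J. trunc (llr d v k (X k \<omega>)) + tail (llr d v k (X k \<omega>))) - mean_LLR d m\<bar>)
        \<le> 2 * \<eta> * real (card J) + 2 * K * sqrt (real (card J))"
    proof (rule Q.expectation_abs_centered_sum_le)
      have "Q.indep_vars (\<lambda>_. \<mu>) X J"
        using v by (intro Q.indep_vars_subset[OF indep_P[OF v]]) (auto simp: J_def)
      then show "Q.indep_vars (\<lambda>_. borel) (\<lambda>k \<omega>. trunc (llr d v k (X k \<omega>))) J"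
        by (rule Q.indep_vars_compose2) measurable
      show "integrable (P d v) (\<lambda>\<omega>. tail (llr d v k (X k \<omega>)))" if k: "k \<in> J" for k
        using llr_int[OF k]
      proof (rule Bochner_Integration.integrable_bound)
        show "(\<lambda>\<omega>. tail (llr d v k (X k \<omega>))) \<in> borel_measurable (P d v)" using k by measurable
      qed (auto simp: tail_def)
      show "(\<Sum>k\<in>J. Q.expectation (\<lambda>\<omega>. trunc (llr d v k (X k \<omega>)) + tail (llr d v k (X k \<omega>)))) = mean_LLR d m"
        unfolding split[symmetric] mean_LLR_def
        unfolding sum_two_phases[where v = v, symmetric] J_def[symmetric]
        by (intro sum.cong refl llr_mean)
    qed (auto simp: J_def trunc_def K_def tail_small)
    then show "(LINT \<omega>|P d v. \<bar>LLR d v (v + m - 1) \<omega> - mean_LLR d m\<bar>) \<le> 2 * \<eta> * real m + 2 * K * sqrt (real m)"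
      unfolding split[symmetric] LLR_def J by (simp add: J_def)
  qed
qed

text \<open>Markov's inequality for the absolute deviation: exceeding a forces a deviation from the
  mean of at least a - \<open>mean_LLR d m\<close>.\<close>

lemma LLR_tail_bound:
  assumes \<eta>: "0 < \<eta>"
  shows "\<exists>K\<ge>0. \<forall>d v m a. 1 \<le> v \<longrightarrow> 1 \<le> m \<longrightarrow> mean_LLR d m < a \<longrightarrow>
    measure (P d v) {\<omega> \<in> space Pinf. a < LLR d v (v + m - 1) \<omega>}
      \<le> (2 * \<eta> * real m + 2 * K * sqrt (real m)) / (a - mean_LLR d m)"
proof -
  obtain K where K: "0 \<le> K" and dev: "\<And>d v m. 1 \<le> v \<Longrightarrow> 1 \<le> m \<Longrightarrow>
      integrable (P d v) (LLR d v (v + m - 1)) \<and>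
      (LINT \<omega>|P d v. \<bar>LLR d v (v + m - 1) \<omega> - mean_LLR d m\<bar>) \<le> 2 * \<eta> * real m + 2 * K * sqrt (real m)"
    using LLR_mean_deviation[OF \<eta>] by blast
  have "measure (P d v) {\<omega> \<in> space Pinf. a < LLR d v (v + m - 1) \<omega>}
      \<le> (2 * \<eta> * real m + 2 * K * sqrt (real m)) / (a - mean_LLR d m)"
    if v: "1 \<le> v" and m: "1 \<le> m" and a: "mean_LLR d m < a" for d v m a
  proof -
    interpret Q: prob_space "P d v" using v by (rule prob_P)
    define Y where "Y = (\<lambda>\<omega>. \<bar>LLR d v (v + m - 1) \<omega> - mean_LLR d m\<bar>)"
    have Y: "integrable (P d v) Y" unfolding Y_def using dev[OF v m, of d] by auto
    then have [measurable]: "Y \<in> borel_measurable (P d v)" by auto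
    have "measure (P d v) {\<omega> \<in> space Pinf. a < LLR d v (v + m - 1) \<omega>}
        \<le> measure (P d v) {\<omega> \<in> space (P d v). a - mean_LLR d m \<le> Y \<omega>}"
    proof (rule Q.finite_measure_mono)
      show "{\<omega> \<in> space Pinf. a < LLR d v (v + m - 1) \<omega>} \<subseteq> {\<omega> \<in> space (P d v). a - mean_LLR d m \<le> Y \<omega>}"
        by (auto simp: space_P[OF v] Y_def)
    qed measurable
    also have "\<dots> \<le> (LINT \<omega>|P d v. Y \<omega>) / (a - mean_LLR d m)"
      using Y a by (intro integral_Markov_inequality_measure[where A = "{}"]) (auto simp: Y_def)
    also have "\<dots> \<le> (2 * \<eta> * real m + 2 * K * sqrt (real m)) / (a - mean_LLR d m)"
      using dev[OF v m, of d] a unfolding Y_def by (intro divide_right_mono) auto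
    finally show ?thesis .
  qed
  with K show ?thesis by blast
qed

section \<open>Lower bounds for the Pollak delay, for a fixed window and then asymptotically\<close>

text \<open>The length-\<open>m\<close> window after \<open>v\<close> is chosen so rarely hit under \<open>Pinf\<close> that the change of measure
  cannot make stopping in it likely, unless the log-likelihood ratio exceeds \<open>a\<close>; the latter event is
  independent of \<open>v \<le> \<tau>\<close>.\<close>

lemma pollak_lower_bound:
  assumes \<tau>: "stopping_time F \<tau>" and \<gamma>: "0 < \<gamma>" "ennreal \<gamma> \<le> (\<integral>\<^sup>+\<omega>. ennreal_of_enat (\<tau> \<omega>) \<partial>Pinf)"
    and m: "1 \<le> m"
    and tail: "\<And>v. 1 \<le> v \<Longrightarrow> measure (P d v) {\<omega> \<in> space Pinf. a < LLR d v (v + m - 1) \<omega>} \<le> p"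
  shows "ennreal (real m * (1 - exp a * (2 * real m / \<gamma>) - p)) \<le> pollak_delay (P d) \<tau>"
proof -
  interpret Pinf: prob_space Pinf by (rule prob_inf)
  have \<tau>m [measurable]: "\<tau> \<in> measurable Pinf (count_space UNIV)"
    using \<tau> by (rule stopping_time_measurable)
  obtain v where v: "1 \<le> v" and win: "Pinf.prob {\<omega> \<in> space Pinf. enat v \<le> \<tau> \<omega> \<and> \<tau> \<omega> < enat (v + m)}
    < 2 * real m / \<gamma> * Pinf.prob {\<omega> \<in> space Pinf. enat v \<le> \<tau> \<omega>}"
    using Pinf.exists_rare_window[OF \<tau>m m \<gamma>] by blast
  interpret Q: prob_space "P d v" using v by (rule prob_P)
  have [measurable]: "\<tau> \<in> measurable (P d v) (count_space UNIV)" using v \<tau>m by (simp add: measurable_P_iff)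
  define A where "A = {\<omega> \<in> space Pinf. enat v \<le> \<tau> \<omega>}"
  define W where "W = {\<omega> \<in> space Pinf. enat v \<le> \<tau> \<omega> \<and> \<tau> \<omega> < enat (v + m)}"
  define C where "C = {\<omega> \<in> space Pinf. enat (v + m) \<le> \<tau> \<omega>}"
  have AF: "A \<in> sets (F (enat (v - 1)))" unfolding A_def using \<tau> v by (rule stopping_time_ge_sets)
  have CF: "C \<in> sets (F (enat (v + m - 1)))"
    unfolding C_def using \<tau> v by (intro stopping_time_ge_sets) auto
  have W_eq: "W = A - C" by (auto simp: W_def A_def C_def not_le)
  have CA: "C \<subseteq> A"
    unfolding A_def C_def by (auto intro: order_trans[rotated])
  \<comment> \<open>Whether \<tau> stops in the window is decided by time v + m - 1, so the change
    of measure involves only the m post-change observations of the window.\<close>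
  have "A \<in> sets (F (enat (v + m - 1)))"
    using AF sets_F_mono[of "enat (v - 1)" "enat (v + m - 1)"] diff_le_mono[of v "v + m" 1] by auto
  with CF have WF: "W \<in> sets (F (enat (v + m - 1)))" unfolding W_eq by auto
  have sets [measurable]: "A \<in> sets (P d v)" "C \<in> sets (P d v)"
    using AF CF sets_F_subset v by (auto simp: sets_P)
  define q where "q = measure (P d v) A"
  \<comment> \<open>The event is decided before the change, so the rare-window bound can be stated
    with its probability under \<open>P d v\<close>.\<close>
  have q: "q = Pinf.prob A" unfolding q_def using v AF by (rule prob_P_before_change)
  have win': "Pinf.prob W < 2 * real m / \<gamma> * q" using win unfolding q W_def A_def .
  \<comment> \<open>The strict inequality forces q > 0, so conditioning on \<open>A\<close> is
    legitimate.\<close>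
  moreover have "0 \<le> Pinf.prob W" by simp
  ultimately have "0 < 2 * real m / \<gamma> * q" by linarith
  then have q0: "0 < q" using m \<gamma> by (simp add: zero_less_mult_iff zero_less_divide_iff)
  define \<Lambda> where "\<Lambda> = LLR d v (v + m - 1)"
  have \<Lambda> [measurable]: "\<Lambda> \<in> borel_measurable (P d v)"
    unfolding \<Lambda>_def using v LLR_measurable by (simp add: measurable_P_iff)
  have AL: "{\<omega> \<in> A. a < \<Lambda> \<omega>} = A \<inter> {\<omega> \<in> space (P d v). a < \<Lambda> \<omega>}"
    using v by (auto simp: A_def space_P)
  have AL_sets: "{\<omega> \<in> A. a < \<Lambda> \<omega>} \<in> sets (P d v)" unfolding AL by measurable
  have "measure (P d v) W \<le> exp a * Pinf.prob W + measure (P d v) {\<omega> \<in> W. a < \<Lambda> \<omega>}"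
    unfolding \<Lambda>_def using v WF by (rule prob_P_le_change_of_measure)
  \<comment> \<open>Enlarging \<open>W\<close> to \<open>A\<close>, which is decided before
    \<open>v\<close>, makes room for independence and produces the factor q on this term
    too.\<close>
  also have "measure (P d v) {\<omega> \<in> W. a < \<Lambda> \<omega>} \<le> measure (P d v) {\<omega> \<in> A. a < \<Lambda> \<omega>}"
    using AL_sets by (intro Q.finite_measure_mono) (auto simp: W_eq)
  also have "\<dots> = q * measure (P d v) {\<omega> \<in> space Pinf. a < \<Lambda> \<omega>}"
    unfolding \<Lambda>_def q_def using v AF by (rule prob_P_indep_LLR)
  also have "\<dots> \<le> q * p"
    using q0 tail[OF v] unfolding \<Lambda>_def by (intro mult_left_mono) auto
  also have "exp a * Pinf.prob W \<le> exp a * (2 * real m / \<gamma> * q)"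
    using win' by (intro mult_left_mono) auto
  finally have "measure (P d v) W \<le> q * (exp a * (2 * real m / \<gamma>) + p)"
    by (simp add: algebra_simps)
  moreover have "measure (P d v) W = q - measure (P d v) C"
    unfolding W_eq q_def using CA by (intro Q.finite_measure_Diff) auto
  ultimately have C: "q * (1 - exp a * (2 * real m / \<gamma>) - p) \<le> measure (P d v) C"
    by (simp add: algebra_simps)
  \<comment> \<open>On \<open>C\<close> the delay is at least m, so the conditional mean delay is at
    least m times the conditional probability of \<open>C\<close> given \<open>A\<close>.\<close>
  have "ennreal (real m * (1 - exp a * (2 * real m / \<gamma>) - p)) \<le> ennreal (real m * measure (P d v) C / q)"
    using C q0 unfolding times_divide_eq_right[symmetric]
    by (intro ennreal_leI mult_left_mono) (simp_all only: pos_le_divide_eq mult.commute of_nat_0_le_iff)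
  also have "\<dots> = ennreal (real m) * emeasure (P d v) C / emeasure (P d v) A"
    using q0 by (simp add: Q.emeasure_eq_measure q_def[symmetric] divide_ennreal ennreal_mult'[symmetric])
  also have "ennreal (real m) * emeasure (P d v) C = (\<integral>\<^sup>+\<omega>. ennreal (real m) * indicator C \<omega> \<partial>P d v)"
    by (simp add: nn_integral_cmult_indicator)
  also have "\<dots> / emeasure (P d v) A
      \<le> (\<integral>\<^sup>+\<omega>. ennreal_of_enat (\<tau> \<omega> - enat v) * indicator A \<omega> \<partial>P d v) / emeasure (P d v) A"
  proof (intro divide_right_mono_ennreal nn_integral_mono)
    fix \<omega>
    show "ennreal (real m) * indicator C \<omega> \<le> ennreal_of_enat (\<tau> \<omega> - enat v) * indicator A \<omega>"
    proof (cases "\<omega> \<in> C")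
      case True
      then have "enat m \<le> \<tau> \<omega> - enat v" by (cases "\<tau> \<omega>") (auto simp: C_def)
      then have "ennreal_of_enat (enat m) \<le> ennreal_of_enat (\<tau> \<omega> - enat v)"
        by (subst ennreal_of_enat_le_iff)
      then show ?thesis using True CA by (auto simp: ennreal_of_nat_eq_real_of_nat)
    qed simp
  qed
  also have "\<dots> = (\<integral>\<^sup>+\<omega>. ennreal_of_enat (\<tau> \<omega> - enat v) \<partial>uniform_measure (P d v) A)"
    by (subst nn_integral_uniform_measure) (auto intro: measurable_compose)
  also have "\<dots> \<le> pollak_delay (P d) \<tau>"
    unfolding pollak_delay_def A_def using v by (intro SUP_upper2[of v]) (auto simp: space_P)
  finally show ?thesis .
qed

text \<open>Reduces each regime to a drift computation: a window of length about \<beta> log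
  \<gamma> is survived with probability close to 1 as long as its mean log-likelihood ratio stays
  below log \<gamma> by a fixed factor.\<close>

lemma pollak_asymptotic_lower_bound:
  fixes D :: "real \<Rightarrow> nat"
  assumes \<beta>: "0 < \<beta>" and L: "L < 1" and \<epsilon>: "0 < \<epsilon>" "\<epsilon> < 1"
    and mean: "\<forall>\<^sub>F \<gamma> in at_top. mean_LLR (D \<gamma>) (nat \<lfloor>\<beta> * ln \<gamma>\<rfloor>) \<le> L * ln \<gamma>"
  shows "\<forall>\<^sub>F \<gamma> in at_top. ennreal (\<beta> * ln \<gamma> * (1 - \<epsilon>)) \<le> (INF \<tau>\<in>arl_class Pinf F \<gamma>. pollak_delay (P (D \<gamma>)) \<tau>)"
proof -
  \<comment> \<open>The threshold \<alpha> log \<gamma> lies halfway between L log \<gamma> and log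
    \<gamma>: \<alpha> < 1 makes the change-of-measure term vanish, and \<alpha> - L = \<kappa>
    leaves a gap linear in log \<gamma> for the tail bound.\<close>
  define \<alpha> where "\<alpha> = (1 + L) / 2"
  define \<kappa> where "\<kappa> = (1 - L) / 2"
  have \<kappa>: "0 < \<kappa>" "\<alpha> < 1" "\<alpha> - L = \<kappa>" using L by (auto simp: \<alpha>_def \<kappa>_def field_simps)
  \<comment> \<open>Chosen so that the linear part 2 \<eta> \<beta> / \<kappa> of the tail bound
    equals \<epsilon>/2.\<close>
  define \<eta> where "\<eta> = \<epsilon> * \<kappa> / (4 * \<beta>)"
  have \<eta>: "0 < \<eta>" using \<epsilon> \<kappa> \<beta> by (simp add: \<eta>_def)
  obtain K where K: "0 \<le> K" and tail: "\<And>d v m a. 1 \<le> v \<Longrightarrow> 1 \<le> m \<Longrightarrow> mean_LLR d m < a \<Longrightarrow>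
    measure (P d v) {\<omega> \<in> space Pinf. a < LLR d v (v + m - 1) \<omega>}
      \<le> (2 * \<eta> * real m + 2 * K * sqrt (real m)) / (a - mean_LLR d m)"
    using LLR_tail_bound[OF \<eta>] by blast
  define C where "C = 2 * K * sqrt \<beta> / \<kappa>"
  define G where "G = (\<lambda>x. 1 - 2 * \<beta> * x * exp (- ((1 - \<alpha>) * x)) - \<epsilon> / 2 - C / sqrt x)"
  have "\<forall>\<^sub>F \<gamma>::real in at_top. \<beta> * ln \<gamma> * (1 - \<epsilon>) \<le> (\<beta> * ln \<gamma> - 1) * G (ln \<gamma>)"
    unfolding G_def
    by (rule eventually_compose_filterlim[OF window_asymptotics[OF \<kappa>(2) \<beta> \<epsilon>(1)] ln_at_top])
  \<comment> \<open>Guarantees a nonempty window after rounding down.\<close>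
  moreover have "\<forall>\<^sub>F \<gamma>::real in at_top. 2 < \<beta> * ln \<gamma>"
    using \<beta> by real_asymp
  ultimately show ?thesis using mean eventually_gt_at_top[of "1::real"]
  proof eventually_elim
    case (elim \<gamma>)
    define x where "x = ln \<gamma>"
    define m where "m = nat \<lfloor>\<beta> * x\<rfloor>"
    define d where "d = D \<gamma>"
    define p where "p = (2 * \<eta> * real m + 2 * K * sqrt (real m)) / (\<alpha> * x - mean_LLR d m)"
    have x: "0 < x" using elim by (simp add: x_def)
    have ex: "exp x = \<gamma>" using elim by (simp add: x_def)
    have m_le: "real m \<le> \<beta> * x" and m_ge: "\<beta> * x - 1 \<le> real m"
      using elim(2) unfolding m_def x_def by linarith+
    have m1: "1 \<le> m" using m_ge elim(2) unfolding x_def by linarith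
    have gap: "\<kappa> * x \<le> \<alpha> * x - mean_LLR d m"
      using elim(3) unfolding \<kappa>(3)[symmetric] m_def[symmetric] x_def[symmetric] d_def[symmetric]
      by (simp add: algebra_simps)
    moreover have "0 < \<kappa> * x" using \<kappa> x by simp
    ultimately have gap0: "mean_LLR d m < \<alpha> * x" by linarith
    have sm: "sqrt (real m) \<le> sqrt \<beta> * sqrt x"
      using m_le by (simp add: real_sqrt_mult[symmetric])
    have "p \<le> (2 * \<eta> * real m + 2 * K * sqrt (real m)) / (\<kappa> * x)"
      unfolding p_def using gap gap0 \<kappa> x \<eta> K by (intro divide_left_mono) auto
    also have "\<dots> \<le> (2 * \<eta> * (\<beta> * x) + 2 * K * (sqrt \<beta> * sqrt x)) / (\<kappa> * x)"
      using m_le sm \<kappa> x \<eta> K by (intro divide_right_mono add_mono mult_left_mono) auto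
    also have "\<dots> = \<epsilon> / 2 + C * (sqrt x / x)"
      using \<kappa> x \<beta> by (simp add: \<eta>_def C_def field_simps)
    also have "sqrt x / x = 1 / sqrt x" using x by (simp add: field_simps)
    finally have p: "p \<le> \<epsilon> / 2 + C / sqrt x" by simp
    have "exp (\<alpha> * x) * (2 * real m / \<gamma>) \<le> exp (\<alpha> * x) * (2 * (\<beta> * x) / \<gamma>)"
      using m_le elim(4) by (intro mult_left_mono divide_right_mono) auto
    also have "\<dots> = 2 * \<beta> * x * (exp (\<alpha> * x) / exp x)" unfolding ex by simp
    also have "exp (\<alpha> * x) / exp x = exp (- ((1 - \<alpha>) * x))"
      by (simp add: exp_diff[symmetric] algebra_simps)
    finally have G: "G x \<le> 1 - exp (\<alpha> * x) * (2 * real m / \<gamma>) - p"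
      using p unfolding G_def by linarith
    have el: "\<beta> * x * (1 - \<epsilon>) \<le> (\<beta> * x - 1) * G x" "2 < \<beta> * x" using elim(1,2) by (auto simp: x_def)
    \<comment> \<open>Positivity of \<open>G x\<close> is what allows the two lower bounds to be
      multiplied below.\<close>
    have "0 < \<beta> * x * (1 - \<epsilon>)" using \<beta> x \<epsilon> by simp
    with el have "0 < (\<beta> * x - 1) * G x" "0 < \<beta> * x - 1" by linarith+
    then have "0 < G x" using zero_less_mult_pos by blast
    then have "\<beta> * x * (1 - \<epsilon>) \<le> real m * (1 - exp (\<alpha> * x) * (2 * real m / \<gamma>) - p)"
      using m_ge G el by (intro order_trans[OF el(1)] mult_mono) auto
    then have bound: "ennreal (\<beta> * x * (1 - \<epsilon>)) \<le> ennreal (real m * (1 - exp (\<alpha> * x) * (2 * real m / \<gamma>) - p))"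
      by (rule ennreal_leI)
    show ?case
    proof (rule INF_greatest)
      fix \<tau> assume "\<tau> \<in> arl_class Pinf F \<gamma>"
      then have \<tau>: "stopping_time F \<tau>" "ennreal \<gamma> \<le> (\<integral>\<^sup>+\<omega>. ennreal_of_enat (\<tau> \<omega>) \<partial>Pinf)"
        by (auto simp: arl_class_def)
      have "ennreal (real m * (1 - exp (\<alpha> * x) * (2 * real m / \<gamma>) - p)) \<le> pollak_delay (P d) \<tau>"
        using elim(4) m1 gap0 unfolding p_def by (intro pollak_lower_bound \<tau> tail) auto
      with bound show "ennreal (\<beta> * ln \<gamma> * (1 - \<epsilon>)) \<le> pollak_delay (P (D \<gamma>)) \<tau>"
        unfolding x_def d_def by (rule order_trans)
    qed
  qed
qed

text \<open>A window slightly shorter than log \<gamma> / I1 eventually lies inside the transient,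
  so only \<open>I1\<close> enters its mean. Taking \<open>c\<close> in \<open>ereal\<close>
  includes the case of an infinite limit.\<close>

lemma pollak_long_transient:
  fixes D :: "real \<Rightarrow> nat" and c :: ereal
  assumes D: "((\<lambda>\<gamma>. ereal (real (D \<gamma>) * I1 / ln \<gamma>)) \<longlongrightarrow> c) at_top" and c: "1 \<le> c"
    and \<epsilon>: "0 < \<epsilon>" "\<epsilon> < 1"
  shows "\<forall>\<^sub>F \<gamma> in at_top. ennreal (1 / I1 * ln \<gamma> * (1 - \<epsilon>)) \<le> (INF \<tau>\<in>arl_class Pinf F \<gamma>. pollak_delay (P (D \<gamma>)) \<tau>)"
proof -
  define \<beta> where "\<beta> = (1 - \<epsilon> / 2) / I1"
  have \<beta>: "0 < \<beta>" using \<epsilon> info_pos by (simp add: \<beta>_def)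
  have "ereal (1 - \<epsilon> / 2) < c" using c \<epsilon> by (intro less_le_trans[OF _ c]) (simp add: one_ereal_def)
  then have "\<forall>\<^sub>F \<gamma> in at_top. ereal (1 - \<epsilon> / 2) < ereal (real (D \<gamma>) * I1 / ln \<gamma>)"
    by (rule order_tendstoD(1)[OF D])
  then have "\<forall>\<^sub>F \<gamma> in at_top. mean_LLR (D \<gamma>) (nat \<lfloor>\<beta> * ln \<gamma>\<rfloor>) \<le> (1 - \<epsilon> / 2) * ln \<gamma>"
    using eventually_gt_at_top[of "1::real"]
  proof eventually_elim
    case (elim \<gamma>)
    have x: "0 < ln \<gamma>" using elim by simp
    define m where "m = nat \<lfloor>\<beta> * ln \<gamma>\<rfloor>"
    have "0 \<le> \<beta> * ln \<gamma>" using \<beta> x by simp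
    then have m: "real m \<le> \<beta> * ln \<gamma>" unfolding m_def by linarith
    have mI: "real m * I1 \<le> (1 - \<epsilon> / 2) * ln \<gamma>"
      using m info_pos by (simp add: \<beta>_def field_simps)
    also have "\<dots> < real (D \<gamma>) * I1" using elim x by (simp add: field_simps)
    finally have "m \<le> D \<gamma>" using info_pos by simp
    then show ?case using mI by (simp add: mean_LLR_def m_def[symmetric])
  qed
  then have "\<forall>\<^sub>F \<gamma> in at_top. ennreal (\<beta> * ln \<gamma> * (1 - \<epsilon> / 2)) \<le> (INF \<tau>\<in>arl_class Pinf F \<gamma>. pollak_delay (P (D \<gamma>)) \<tau>)"
    using \<beta> \<epsilon> by (intro pollak_asymptotic_lower_bound) auto
  then show ?thesis
    using eventually_gt_at_top[of "1::real"]
  proof eventually_elim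
    case (elim \<gamma>)
    \<comment> \<open>One factor 1 - \<epsilon>/2 comes from shortening the window, the other from
      the asymptotic bound.\<close>
    have "1 - \<epsilon> \<le> (1 - \<epsilon> / 2) * (1 - \<epsilon> / 2)" by (simp add: algebra_simps)
    then have "(ln \<gamma> / I1) * (1 - \<epsilon>) \<le> (ln \<gamma> / I1) * ((1 - \<epsilon> / 2) * (1 - \<epsilon> / 2))"
      using elim(2) info_pos by (intro mult_left_mono) auto
    then have "1 / I1 * ln \<gamma> * (1 - \<epsilon>) \<le> \<beta> * ln \<gamma> * (1 - \<epsilon> / 2)" by (simp add: \<beta>_def mult_ac)
    with elim(1) show ?case by (rule order_trans[OF ennreal_leI, rotated])
  qed
qed

text \<open>The transient contributes about c log \<gamma> to the drift, and the remaining (1 - c)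
  log \<gamma> accumulates at rate \<open>I2\<close>; together these phases last log \<gamma> ((1 -
  c)/I2 + c/I1). Shortening this window slightly keeps the mean below log \<gamma>.\<close>

lemma pollak_short_transient:
  fixes D :: "real \<Rightarrow> nat" and c :: real
  assumes D: "((\<lambda>\<gamma>. real (D \<gamma>) * I1 / ln \<gamma>) \<longlongrightarrow> c) at_top" and c: "0 \<le> c" "c < 1"
    and \<epsilon>: "0 < \<epsilon>" "\<epsilon> < 1"
  shows "\<forall>\<^sub>F \<gamma> in at_top. ennreal (((1 - c) / I2 + c / I1) * ln \<gamma> * (1 - \<epsilon>))
    \<le> (INF \<tau>\<in>arl_class Pinf F \<gamma>. pollak_delay (P (D \<gamma>)) \<tau>)"
proof -
  define B where "B = (1 - c) / I2 + c / I1"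
  define \<beta> where "\<beta> = (1 - \<epsilon> / 2) * B"
  define \<rho> where "\<rho> = I2 / I1"
  have B: "0 < B" unfolding B_def using c info_pos by (intro add_pos_nonneg) auto
  have BI: "B * I2 = 1 - c + c * \<rho>"
    using info_pos by (simp add: B_def \<rho>_def distrib_right)
  have \<beta>: "0 < \<beta>" using \<epsilon> B by (simp add: \<beta>_def)
  \<comment> \<open>The slack in the drift, in units of log \<gamma>, gained by shortening the
    window by the factor 1 - \<epsilon>/2.\<close>
  define \<theta> where "\<theta> = \<epsilon> / 2 * (B * I2)"
  have \<theta>: "0 < \<theta>" using \<epsilon> B info_pos by (simp add: \<theta>_def)
  define s where "s = \<bar>1 - \<rho>\<bar> + 1"
  have s: "0 < s" by (simp add: s_def add_nonneg_pos)
  \<comment> \<open>The tolerance for d I1 / log \<gamma> serves two cases: a window inside the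
    transient needs c + \<delta> \<le> (1 + c)/2, and a longer one needs the error \<delta> |1 -
    \<rho>| to use at most half of the slack. The 1 added in \<open>s\<close> avoids division by 0
    when \<rho> = 1.\<close>
  define \<delta> where "\<delta> = min ((1 - c) / 2) (\<theta> / (2 * s))"
  have \<delta>: "0 < \<delta>" using c \<theta> s by (simp add: \<delta>_def)
  have \<delta>1: "\<delta> \<le> (1 - c) / 2" unfolding \<delta>_def by (rule min.cobounded1)
  have "\<delta> * s \<le> \<theta> / (2 * s) * s"
    unfolding \<delta>_def using s by (intro mult_right_mono min.cobounded2) simp
  also have "\<dots> = \<theta> / 2" using s by simp
  finally have \<delta>2: "\<delta> * \<bar>1 - \<rho>\<bar> \<le> \<theta> / 2" using \<delta> by (simp add: s_def distrib_left)
  define L where "L = max ((1 + c) / 2) (1 - \<theta> / 2)"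
  have L: "L < 1" using c \<theta> by (simp add: L_def)
  have "\<forall>\<^sub>F \<gamma> in at_top. dist (real (D \<gamma>) * I1 / ln \<gamma>) c < \<delta>"
    using D \<delta> by (rule tendstoD)
  then have "\<forall>\<^sub>F \<gamma> in at_top. mean_LLR (D \<gamma>) (nat \<lfloor>\<beta> * ln \<gamma>\<rfloor>) \<le> L * ln \<gamma>"
    using eventually_gt_at_top[of "1::real"]
  proof eventually_elim
    case (elim \<gamma>)
    define x where "x = ln \<gamma>"
    define u where "u = real (D \<gamma>) * I1"
    define m where "m = nat \<lfloor>\<beta> * x\<rfloor>"
    have x: "0 < x" using elim by (simp add: x_def)
    have "0 \<le> \<beta> * x" using \<beta> x by simp
    then have m: "real m \<le> \<beta> * x" unfolding m_def by linarith
    have "\<bar>u / x - c\<bar> * x \<le> \<delta> * x"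
      using elim(1) x by (intro mult_right_mono) (auto simp: dist_real_def u_def x_def)
    moreover have "u - c * x = (u / x - c) * x" using x by (simp add: field_simps)
    ultimately have u: "\<bar>u - c * x\<bar> \<le> \<delta> * x" using x by (simp add: abs_mult)
    have "mean_LLR (D \<gamma>) m \<le> L * x"
    proof (cases "m \<le> D \<gamma>")
      \<comment> \<open>Shortening may leave the window inside the transient; the drift is then at
        most that of the whole transient.\<close>
      case True
      then have "mean_LLR (D \<gamma>) m \<le> u"
        using info_pos by (simp add: mean_LLR_def u_def)
      also have "\<dots> \<le> c * x + \<delta> * x" using u by linarith
      also have "\<dots> \<le> (c + (1 - c) / 2) * x"
        using \<delta>1 x by (simp add: distrib_right)
      also have "\<dots> \<le> L * x" using x by (intro mult_right_mono) (auto simp: L_def field_simps)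
      finally show ?thesis .
    next
      case False
      \<comment> \<open>The mean is d I1 + (m - d) I2, and d I2 = u \<rho>. The coefficient 1 -
        \<rho> may have either sign, whence the two-sided control of u.\<close>
      then have "mean_LLR (D \<gamma>) m = real m * I2 + u * (1 - \<rho>)"
        using info_pos by (simp add: mean_LLR_def u_def \<rho>_def of_nat_diff algebra_simps)
      also have "\<dots> \<le> \<beta> * x * I2 + (c * x * (1 - \<rho>) + \<delta> * x * \<bar>1 - \<rho>\<bar>)"
      proof (intro add_mono)
        show "real m * I2 \<le> \<beta> * x * I2" using m info_pos by (intro mult_right_mono) auto
        have "(u - c * x) * (1 - \<rho>) \<le> \<bar>u - c * x\<bar> * \<bar>1 - \<rho>\<bar>" by (metis abs_ge_self abs_mult)
        also have "\<dots> \<le> \<delta> * x * \<bar>1 - \<rho>\<bar>" using u by (intro mult_right_mono) auto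
        finally show "u * (1 - \<rho>) \<le> c * x * (1 - \<rho>) + \<delta> * x * \<bar>1 - \<rho>\<bar>" by (simp add: left_diff_distrib)
      qed
      also have "\<dots> = (B * I2 - \<theta> + c * (1 - \<rho>) + \<delta> * \<bar>1 - \<rho>\<bar>) * x"
        by (simp add: \<beta>_def \<theta>_def algebra_simps)
      also have "\<dots> = (1 - \<theta> + \<delta> * \<bar>1 - \<rho>\<bar>) * x" unfolding BI by (simp add: algebra_simps)
      also have "\<dots> \<le> (1 - \<theta> / 2) * x" using \<delta>2 x by (intro mult_right_mono) auto
      also have "\<dots> \<le> L * x" using x by (intro mult_right_mono) (auto simp: L_def)
      finally show ?thesis .
    qed
    then show ?case by (simp add: x_def m_def)
  qed
  then have "\<forall>\<^sub>F \<gamma> in at_top. ennreal (\<beta> * ln \<gamma> * (1 - \<epsilon> / 2)) \<le> (INF \<tau>\<in>arl_class Pinf F \<gamma>. pollak_delay (P (D \<gamma>)) \<tau>)"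
    using \<beta> \<epsilon> L by (intro pollak_asymptotic_lower_bound) auto
  then show ?thesis
    using eventually_gt_at_top[of "1::real"]
  proof eventually_elim
    case (elim \<gamma>)
    have "1 - \<epsilon> \<le> (1 - \<epsilon> / 2) * (1 - \<epsilon> / 2)" by (simp add: algebra_simps)
    then have "(B * ln \<gamma>) * (1 - \<epsilon>) \<le> (B * ln \<gamma>) * ((1 - \<epsilon> / 2) * (1 - \<epsilon> / 2))"
      using elim(2) B by (intro mult_left_mono) auto
    then have "B * ln \<gamma> * (1 - \<epsilon>) \<le> \<beta> * ln \<gamma> * (1 - \<epsilon> / 2)" by (simp add: \<beta>_def mult_ac)
    with elim(1) show ?case unfolding B_def by (rule order_trans[OF ennreal_leI, rotated])
  qed
qed

end

theorem theorem2:
  fixes \<mu> :: "'a measure"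
    and f0 f1 f2 :: "'a \<Rightarrow> real"
    and Pinf :: "'w measure"
    and P :: "nat \<Rightarrow> nat \<Rightarrow> 'w measure"
    and X :: "nat \<Rightarrow> 'w \<Rightarrow> 'a"
    and d :: "real \<Rightarrow> nat"
    and c :: ereal
  assumes model: "transient_change_model \<mu> f0 f1 f2 Pinf P X"
    and d_inf: "filterlim d at_top at_top"
    and c_nonneg: "0 \<le> c"
    and d_asymp: "((\<lambda>\<gamma>. ereal (real (d \<gamma>) * KL_info \<mu> f1 f0 / ln \<gamma>)) \<longlongrightarrow> c) at_top"
  shows
    "let F = obs_filtration (space Pinf) \<mu> X;
         I1 = KL_info \<mu> f1 f0;
         I2 = KL_info \<mu> f2 f0;
         inf_L = (\<lambda>\<gamma>. INF \<tau>\<in>arl_class Pinf F \<gamma>. lorden_delay (P (d \<gamma>)) F \<tau>);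
         inf_P = (\<lambda>\<gamma>. INF \<tau>\<in>arl_class Pinf F \<gamma>. pollak_delay (P (d \<gamma>)) \<tau>)
     in
       (1 \<le> c \<longrightarrow>
          (\<exists>r\<in>o[at_top](\<lambda>_::real. 1::real). \<forall>\<^sub>F \<gamma> in at_top.
             inf_L \<gamma> \<ge> inf_P \<gamma> \<and>
             inf_P \<gamma> \<ge> ennreal (ln \<gamma> / I1 * (1 - r \<gamma>)))) \<and>
       (c < 1 \<longrightarrow>
          (\<exists>r\<in>o[at_top](\<lambda>_::real. 1::real). \<forall>\<^sub>F \<gamma> in at_top.
             inf_L \<gamma> \<ge> inf_P \<gamma> \<and>
             inf_P \<gamma> \<ge> ennreal (ln \<gamma> *
               ((1 - real_of_ereal c) / I2 + real_of_ereal c / I1) * (1 - r \<gamma>))))"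
proof -
  interpret transient_change_model \<mu> f0 f1 f2 Pinf P X by (rule model)
  define g where "g = (\<lambda>\<gamma>. INF \<tau>\<in>arl_class Pinf F \<gamma>. pollak_delay (P (d \<gamma>)) \<tau>)"
  have LP: "g \<gamma> \<le> (INF \<tau>\<in>arl_class Pinf F \<gamma>. lorden_delay (P (d \<gamma>)) F \<tau>)" for \<gamma>
    unfolding g_def
    by (intro INF_mono) (auto simp: arl_class_def intro: pollak_le_lorden)
  have 1: "\<exists>r\<in>o[at_top](\<lambda>_::real. 1::real). \<forall>\<^sub>F \<gamma> in at_top. ennreal (ln \<gamma> / I1 * (1 - r \<gamma>)) \<le> g \<gamma>" if "1 \<le> c"
    using exists_smallo_remainder[of "1 / I1" g] pollak_long_transient[OF d_asymp that] info_pos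
    by (simp add: g_def)
  have 2: "\<exists>r\<in>o[at_top](\<lambda>_::real. 1::real). \<forall>\<^sub>F \<gamma> in at_top.
      ennreal (ln \<gamma> * ((1 - real_of_ereal c) / I2 + real_of_ereal c / I1) * (1 - r \<gamma>)) \<le> g \<gamma>" if c1: "c < 1"
  proof (rule exists_smallo_remainder)
    \<comment> \<open>A limit in [0, 1) is real, so convergence in \<open>ereal\<close> becomes
      ordinary convergence.\<close>
    obtain c' where c': "c = ereal c'" "0 \<le> c'" "c' < 1"
      using c_nonneg c1 by (cases c rule: ereal_cases) auto
    show "0 < (1 - real_of_ereal c) / I2 + real_of_ereal c / I1"
      using c' info_pos by (auto intro!: add_pos_nonneg)
    show "\<forall>\<^sub>F \<gamma> in at_top. ennreal (((1 - real_of_ereal c) / I2 + real_of_ereal c / I1) * ln \<gamma> * (1 - \<epsilon>)) \<le> g \<gamma>"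
      if "0 < \<epsilon>" "\<epsilon> < 1" for \<epsilon>
      using pollak_short_transient[of d c' \<epsilon>] d_asymp c' that by (simp add: g_def)
  qed
  show ?thesis
    using 1 2 LP unfolding Let_def g_def[symmetric] by (auto simp: g_def)
qed

end
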